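(* Consider the normal mean model $P_\theta=\mathcal N(\theta,1)$, $\theta\in\mathbb R$. (i) (Compactly supported case.) For any $h>0$, there exist constants $c_0=c_0(h)>0$ and $n_0$ such that for all $n\ge n_0$, $$R_n(\mathcal P([-h,h]))\ \ge\ \frac{c_0}{n}\,\frac{\log n}{\log\log n},$$ where $\mathcal P([-h,h])$ is the set of all probability distributions supported on $[-h,h]$. (ii) (Subgaussian case.) For any $s>0$, there exist constants $c_1=c_1(s)>0$ and $n_0$ such that for all $n\ge n_0$, $$R_n(\mathsf{SubG}(s))\ \ge\ \frac{c_1}{n}\log n,$$ where $\mathsf{SubG}(s)=\{G:\ G([-t,t]^c)\le 2e^{-t^2/(2s)}\ \ \forall t>0\}$.
   Context: For a prior $G$ on $\mathbb R$, $f_G(y)=\int\varphi(y-\theta)\,G(d\theta)$ is the Gaussian mixture density, with $\varphi(y)=\frac1{\sqrt{2\pi}}e^{-y^2/2}$. The minimax squared Hellinger risk for density estimation over the class $\{f_G:G\in\mathcal G\}$ is $$R_n(\mathcal G)=\inf_{\hat f}\sup_{G\in\mathcal G}\mathbb E_G[H^2(f_G,\hat f)],$$ where $\hat f$ is a density estimate measurable with respect to the i.i.d. sample $Y_1,\dots,Y_n\sim f_G$, and $H(f,g)=\left(\int(\sqrt f-\sqrt g)^2\,d\nu\right)^{1/2}$ is the Hellinger distance between densities with respect to the dominating measure $\nu$ (Lebesgue measure here). *)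

theory Defs
  imports "HOL-Probability.Probability"
begin

definition priors :: "real measure set" where
  "priors = {G. prob_space G \<and> sets G = sets borel}"

definition gaussian_mixture :: "real measure \<Rightarrow> real \<Rightarrow> real" where
  "gaussian_mixture G y = (\<integral>\<theta>. std_normal_density (y - \<theta>) \<partial>G)"

definition prob_density :: "'a measure \<Rightarrow> ('a \<Rightarrow> real) \<Rightarrow> bool" where
  "prob_density \<nu> f \<longleftrightarrow>
     f \<in> borel_measurable \<nu> \<and> (\<forall>x\<in>space \<nu>. 0 \<le> f x) \<and> (\<integral>\<^sup>+x. ennreal (f x) \<partial>\<nu>) = 1"

definition hellinger :: "'a measure \<Rightarrow> ('a \<Rightarrow> real) \<Rightarrow> ('a \<Rightarrow> real) \<Rightarrow> real" where
  "hellinger \<nu> f g = sqrt (\<integral>x. (sqrt (f x) - sqrt (g x))\<^sup>2 \<partial>\<nu>)"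

definition sample_law :: "nat \<Rightarrow> real measure \<Rightarrow> (nat \<Rightarrow> real) measure" where
  "sample_law n G =
     (\<Pi>\<^sub>M i\<in>{..<n}. density lborel (\<lambda>y. ennreal (gaussian_mixture G y)))"

text \<open>
  An estimator maps a sample to a density. Measurability is joint in the sample and the
  evaluation point. Estimators need not be of the form \<open>gaussian_mixture G\<close>.
\<close>

definition density_estimators :: "nat \<Rightarrow> ((nat \<Rightarrow> real) \<Rightarrow> real \<Rightarrow> real) set" where
  "density_estimators n =
     {fh. (\<lambda>(Y, y). fh Y y) \<in> borel_measurable ((\<Pi>\<^sub>M i\<in>{..<n}. borel) \<Otimes>\<^sub>M borel) \<and>
          (\<forall>Y\<in>space (\<Pi>\<^sub>M i\<in>{..<n}. (borel :: real measure)). prob_density lborel (fh Y))}"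

text \<open>
  The risk takes values in \<^typ>\<open>ennreal\<close>, so that infimum and supremum are taken in a
  complete lattice and never have an unspecified value.
\<close>

definition minimax_risk :: "nat \<Rightarrow> real measure set \<Rightarrow> ennreal" where
  "minimax_risk n \<G> =
     (INF fh\<in>density_estimators n. SUP G\<in>\<G>.
        \<integral>\<^sup>+Y. ennreal ((hellinger lborel (gaussian_mixture G) (fh Y))\<^sup>2) \<partial>sample_law n G)"

definition supported_priors :: "real set \<Rightarrow> real measure set" where
  "supported_priors A = {G \<in> priors. measure G A = 1}"

definition SubG :: "real \<Rightarrow> real measure set" where
  "SubG s = {G \<in> priors. \<forall>t>0. measure G (- {-t..t}) \<le> 2 * exp (- t\<^sup>2 / (2 * s))}"

end

theory Submission
  imports Defs "HOL-Computational_Algebra.Polynomial"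
begin

text \<open>
  The bounds come from Assouad's lemma (\<open>assouad_minimax_risk\<close>): if \<open>2^m\<close> priors of the class,
  indexed by the subsets of an \<open>m\<close>-element set, have mixture densities whose squared Hellinger distances
  are comparable to the Hamming distance divided by \<open>n\<close>, with a small enough constant for
  neighbours, then the minimax risk is at least a constant times \<open>m/n\<close>. It remains to fit
  \<open>m\<close> of order \<open>log n / log (log n)\<close>, respectively \<open>log n\<close>, into the two classes.

  All priors are discrete, with atoms at \<open>0, b, 2 b, \<dots>, m b\<close>. The base prior puts mass \<open>exp (- m)\<close> on
  each atom other than \<open>0\<close> and has a mixture density \<open>f\<close>. Moving small masses between the atoms perturbs
  \<open>f\<close> within an \<open>m\<close>-dimensional space of functions. As long as every atom keeps between \<open>1/2\<close> and
  \<open>3/2\<close> of its mass, all densities are comparable to \<open>f\<close>, and the squared Hellinger distance is equivalent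
  to the squared norm of \<open>L\<^sup>2(1/f)\<close> (\<open>hellinger_sq_chi2_bounds\<close>). An orthonormal basis of the perturbations
  for this norm, scaled by \<open>1/sqrt (2n)\<close>, therefore spans a hypercube with exactly the geometry that
  Assouad's lemma asks for. The basis comes from the Gram-Schmidt process and need not be known.

  What must be shown is that the orthonormal perturbations move little mass. This is a quantitative
  deconvolution (\<open>grid_coefficient_bound\<close>): if a perturbation has norm \<open>1\<close>, each of its masses is at
  most the norm in \<open>L\<^sup>2(f)\<close> of a function that integrates to \<open>1\<close> against one normal component and to \<open>0\<close>
  against the others. Since \<open>exp (t y)\<close> integrates to \<open>exp (t x + t\<^sup>2/2)\<close> against the normal density with
  mean \<open>x\<close>, such a function is obtained from the Lagrange polynomial for the nodes \<open>exp (\<tau> b i)\<close>, and its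
  norm is at most \<open>(C / (\<tau> b m))\<^sup>m\<close> when \<open>\<tau> b m \<le> 1\<close> and \<open>\<tau>\<close> is of order \<open>1/sqrt m\<close> (\<open>grid_bound_le\<close>).
  The perturbations are admissible as soon as this norm is at most \<open>sqrt n\<close>, up to exponential
  factors in \<open>m\<close>. On \<open>[-h, h]\<close> the range \<open>m b\<close> is bounded and the condition reads
  \<open>(C sqrt m)\<^sup>m \<le> sqrt n\<close>. In the subgaussian class, atoms of mass \<open>exp (- m)\<close> may lie as far out as
  \<open>sqrt (s m)\<close>, so that \<open>\<tau> b m = 1\<close> is possible and the condition becomes \<open>C\<^sup>m \<le> sqrt n\<close>.
\<close>

section \<open>Hellinger distance and affinity\<close>

lemma prob_density_integral:
  assumes "prob_density \<nu> f"
  shows "integrable \<nu> f" "(\<integral>x. f x \<partial>\<nu>) = 1"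
proof -
  have "f \<in> borel_measurable \<nu>" "AE x in \<nu>. 0 \<le> f x" "(\<integral>\<^sup>+x. ennreal (f x) \<partial>\<nu>) = ennreal 1"
    using assms by (auto simp: prob_density_def)
  from nn_integral_eq_integrable[OF this(1,2), of 1] this(3)
  show "integrable \<nu> f" "(\<integral>x. f x \<partial>\<nu>) = 1" by simp_all
qed

lemma sqrt_diff_sq_le:
  fixes a b :: real assumes "0 \<le> a" "0 \<le> b" shows "(sqrt a - sqrt b)\<^sup>2 \<le> a + b"
  using assms by (simp add: power2_diff)

lemma integrable_sqrt_diff_sq:
  assumes f: "prob_density \<nu> f" and g: "prob_density \<nu> g"
  shows "integrable \<nu> (\<lambda>x. (sqrt (f x) - sqrt (g x))\<^sup>2)"
proof (rule Bochner_Integration.integrable_bound)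
  show "integrable \<nu> (\<lambda>x. f x + g x)"
    using prob_density_integral[OF f] prob_density_integral[OF g] by simp
  have [measurable]: "f \<in> borel_measurable \<nu>" "g \<in> borel_measurable \<nu>"
    using f g by (auto simp: prob_density_def)
  show "(\<lambda>x. (sqrt (f x) - sqrt (g x))\<^sup>2) \<in> borel_measurable \<nu>" by measurable
  show "AE x in \<nu>. norm ((sqrt (f x) - sqrt (g x))\<^sup>2) \<le> norm (f x + g x)"
    using f g sqrt_diff_sq_le by (intro AE_I2) (auto simp: prob_density_def)
qed

lemma hellinger_sq:
  "(hellinger \<nu> f g)\<^sup>2 = (\<integral>x. (sqrt (f x) - sqrt (g x))\<^sup>2 \<partial>\<nu>)"
  by (simp add: hellinger_def)

lemma hellinger_sq_triangle:
  assumes f: "prob_density \<nu> f" and g: "prob_density \<nu> g" and k: "prob_density \<nu> k"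
  shows "(hellinger \<nu> f g)\<^sup>2 \<le> 2 * (hellinger \<nu> f k)\<^sup>2 + 2 * (hellinger \<nu> g k)\<^sup>2"
proof -
  have "(sqrt (f x) - sqrt (g x))\<^sup>2
      \<le> 2 * (sqrt (f x) - sqrt (k x))\<^sup>2 + 2 * (sqrt (g x) - sqrt (k x))\<^sup>2" for x
  proof -
    have "(a - b)\<^sup>2 \<le> 2 * (a - c)\<^sup>2 + 2 * (b - c)\<^sup>2" for a b c :: real
      using zero_le_power2[of "a + b - 2 * c"] by (simp add: power2_eq_square algebra_simps)
    then show ?thesis .
  qed
  then have "(hellinger \<nu> f g)\<^sup>2
      \<le> (\<integral>x. 2 * (sqrt (f x) - sqrt (k x))\<^sup>2 + 2 * (sqrt (g x) - sqrt (k x))\<^sup>2 \<partial>\<nu>)"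
    unfolding hellinger_sq
    by (intro integral_mono integrable_sqrt_diff_sq f g Bochner_Integration.integrable_add
        integrable_mult_right k)
  also have "\<dots> = 2 * (hellinger \<nu> f k)\<^sup>2 + 2 * (hellinger \<nu> g k)\<^sup>2"
    unfolding hellinger_sq using f g k
    by (subst Bochner_Integration.integral_add) (auto intro!: integrable_sqrt_diff_sq)
  finally show ?thesis .
qed

text \<open>
  The affinity \<open>\<integral> sqrt (f g)\<close> is what multiplies over independent observations, whereas the
  squared Hellinger distance does not; the estimate for \<open>n\<close> observations goes through this identity.
\<close>

lemma hellinger_affinity:
  assumes f: "prob_density \<nu> f" and g: "prob_density \<nu> g"
  shows "(\<integral>\<^sup>+x. ennreal (sqrt (f x * g x)) \<partial>\<nu>) = ennreal (1 - (hellinger \<nu> f g)\<^sup>2 / 2)"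
proof -
  note fi = prob_density_integral[OF f] and gi = prob_density_integral[OF g]
  have nn: "0 \<le> f x" "0 \<le> g x" if "x \<in> space \<nu>" for x
    using f g that by (auto simp: prob_density_def)
  let ?h = "\<lambda>x. (f x + g x - (sqrt (f x) - sqrt (g x))\<^sup>2) / 2"
  have eq: "sqrt (f x * g x) = ?h x" if "x \<in> space \<nu>" for x
    using nn[OF that] by (simp add: power2_diff real_sqrt_mult)
  have int: "integrable \<nu> ?h"
    using fi gi integrable_sqrt_diff_sq[OF f g] by auto
  have "(\<integral>\<^sup>+x. ennreal (sqrt (f x * g x)) \<partial>\<nu>) = (\<integral>\<^sup>+x. ennreal (?h x) \<partial>\<nu>)"
    by (intro nn_integral_cong) (simp add: eq)
  also have "\<dots> = ennreal (\<integral>x. ?h x \<partial>\<nu>)"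
  proof (rule nn_integral_eq_integral[OF int])
    show "AE x in \<nu>. 0 \<le> ?h x"
    proof (rule AE_I2)
      fix x assume x: "x \<in> space \<nu>"
      then have "0 \<le> sqrt (f x * g x)" using nn by simp
      then show "0 \<le> ?h x" unfolding eq[OF x] .
    qed
  qed
  also have "(\<integral>x. ?h x \<partial>\<nu>) = 1 - (hellinger \<nu> f g)\<^sup>2 / 2"
    unfolding hellinger_sq using fi gi integrable_sqrt_diff_sq[OF f g] by (simp add: diff_divide_distrib)
  finally show ?thesis .
qed

section \<open>Products of densities\<close>

lemma PiM_density_prob:
  assumes f: "prob_density \<nu> f" and "sigma_finite_measure \<nu>" and I: "finite I"
  shows "(\<Pi>\<^sub>M i\<in>I. density \<nu> (\<lambda>x. ennreal (f x)))
       = density (\<Pi>\<^sub>M i\<in>I. \<nu>) (\<lambda>Y. \<Prod>i\<in>I. ennreal (f (Y i)))"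
proof -
  interpret nu: product_sigma_finite "\<lambda>_. \<nu>"
    using assms(2) by (simp add: product_sigma_finite_def)
  have [measurable]: "f \<in> borel_measurable \<nu>" using f by (simp add: prob_density_def)
  have "prob_space (density \<nu> (\<lambda>x. ennreal (f x)))"
    using f by (intro prob_spaceI) (simp add: prob_density_def emeasure_density cong: nn_integral_cong)
  then interpret d: product_sigma_finite "\<lambda>_. density \<nu> (\<lambda>x. ennreal (f x))"
    by (simp add: product_sigma_finite_def prob_space_imp_sigma_finite)
  show ?thesis
  proof (rule d.PiM_eqI[OF I, symmetric])
    show "sets (density (\<Pi>\<^sub>M i\<in>I. \<nu>) (\<lambda>Y. \<Prod>i\<in>I. ennreal (f (Y i))))
        = sets (\<Pi>\<^sub>M i\<in>I. density \<nu> (\<lambda>x. ennreal (f x)))"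
      by (simp cong: sets_PiM_cong)
    fix A assume "\<And>i. i \<in> I \<Longrightarrow> A i \<in> sets (density \<nu> (\<lambda>x. ennreal (f x)))"
    then have A[measurable]: "\<And>i. i \<in> I \<Longrightarrow> A i \<in> sets \<nu>" by simp
    have PA: "Pi\<^sub>E I A \<in> sets (\<Pi>\<^sub>M i\<in>I. \<nu>)"
      by (intro sets_PiM_I_finite I A)
    have "emeasure (density (\<Pi>\<^sub>M i\<in>I. \<nu>) (\<lambda>Y. \<Prod>i\<in>I. ennreal (f (Y i)))) (Pi\<^sub>E I A)
        = (\<integral>\<^sup>+Y. (\<Prod>i\<in>I. ennreal (f (Y i))) * indicator (Pi\<^sub>E I A) Y \<partial>(\<Pi>\<^sub>M i\<in>I. \<nu>))"
      using PA I by (subst emeasure_density) auto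
    also have "\<dots> = (\<integral>\<^sup>+Y. (\<Prod>i\<in>I. ennreal (f (Y i)) * indicator (A i) (Y i)) \<partial>(\<Pi>\<^sub>M i\<in>I. \<nu>))"
    proof (rule nn_integral_cong)
      fix Y assume "Y \<in> space (\<Pi>\<^sub>M i\<in>I. \<nu>)"
      then have "Y \<in> extensional I" by (simp add: space_PiM PiE_def)
      then have "(indicator (Pi\<^sub>E I A) Y :: ennreal) = (\<Prod>i\<in>I. indicator (A i) (Y i))"
        using I by (auto simp: indicator_def PiE_iff prod_zero_iff intro!: prod.neutral)
      then show "(\<Prod>i\<in>I. ennreal (f (Y i))) * indicator (Pi\<^sub>E I A) Y
          = (\<Prod>i\<in>I. ennreal (f (Y i)) * indicator (A i) (Y i))"
        by (simp add: prod.distrib)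
    qed
    also have "\<dots> = (\<Prod>i\<in>I. \<integral>\<^sup>+x. ennreal (f x) * indicator (A i) x \<partial>\<nu>)"
      using A by (intro nu.product_nn_integral_prod[OF I]) measurable
    also have "\<dots> = (\<Prod>i\<in>I. emeasure (density \<nu> (\<lambda>x. ennreal (f x))) (A i))"
      using A by (intro prod.cong refl) (simp add: emeasure_density)
    finally show "emeasure (density (\<Pi>\<^sub>M i\<in>I. \<nu>) (\<lambda>Y. \<Prod>i\<in>I. ennreal (f (Y i)))) (Pi\<^sub>E I A)
        = (\<Prod>i\<in>I. emeasure (density \<nu> (\<lambda>x. ennreal (f x))) (A i))" .
  qed
qed

text \<open>
  Since \<open>a b = min a b * max a b\<close>, this is the arithmetic-geometric mean inequality for \<open>min a b\<close> and
  \<open>max a b / 4\<close>, together with \<open>max a b \<le> a + b\<close>. Integrated against two probability densities it bounds the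
  overlap \<open>\<integral> min\<close> from below by the affinity minus \<open>1/2\<close>, which replaces the usual use of the
  Cauchy-Schwarz inequality and suffices when the affinity is at least \<open>3/4\<close>.
\<close>

lemma sqrt_mult_le_min:
  fixes a b :: real
  assumes "0 \<le> a" "0 \<le> b"
  shows "sqrt (a * b) \<le> min a b + (a + b) / 4"
proof -
  have "sqrt a * sqrt b \<le> a + b / 4" "sqrt a * sqrt b \<le> b + a / 4"
    using assms zero_le_power2[of "sqrt a - sqrt b / 2"] zero_le_power2[of "sqrt b - sqrt a / 2"]
    by (simp_all add: power2_diff power_divide mult.commute)
  then show ?thesis
    using assms by (auto simp: real_sqrt_mult min_def add_divide_distrib)
qed

text \<open>
  Two densities at squared Hellinger distance at most \<open>1/(2n)\<close> cannot be told apart from \<open>n\<close> observations: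
  the affinity of the product densities is \<open>(1 - H\<^sup>2/2)\<^sup>n \<ge> (1 - 1/(4n))\<^sup>n \<ge> 3/4\<close> by Bernoulli's inequality.
\<close>

lemma integral_min_product_ge:
  assumes f: "prob_density \<nu> f" and g: "prob_density \<nu> g" and sf: "sigma_finite_measure \<nu>"
    and n: "0 < n" and H: "(hellinger \<nu> f g)\<^sup>2 \<le> 1 / (2 * real n)"
  shows "ennreal (1 / 4)
    \<le> (\<integral>\<^sup>+Y. ennreal (min (\<Prod>i<n. f (Y i)) (\<Prod>i<n. g (Y i))) \<partial>(\<Pi>\<^sub>M i\<in>{..<n}. \<nu>))"
proof -
  interpret nu: product_sigma_finite "\<lambda>_. \<nu>"
    using sf by (simp add: product_sigma_finite_def)
  let ?L = "\<Pi>\<^sub>M i\<in>{..<n}. \<nu>"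
  let ?P = "\<lambda>h Y. \<Prod>i<n. h (Y i) :: real"
  have [measurable]: "f \<in> borel_measurable \<nu>" "g \<in> borel_measurable \<nu>"
    using f g by (auto simp: prob_density_def)
  have nnf: "\<And>x. x \<in> space \<nu> \<Longrightarrow> 0 \<le> f x" and nng: "\<And>x. x \<in> space \<nu> \<Longrightarrow> 0 \<le> g x"
    using f g by (auto simp: prob_density_def)
  have sp: "Y i \<in> space \<nu>" if "Y \<in> space ?L" "i < n" for Y i
    using that by (auto simp: space_PiM)
  have [measurable]: "?P f \<in> borel_measurable ?L" "?P g \<in> borel_measurable ?L"
    by measurable
  have one: "(\<integral>\<^sup>+Y. ennreal (?P h Y) \<partial>?L) = 1" if h: "prob_density \<nu> h" for h
  proof -
    have "(\<integral>\<^sup>+Y. ennreal (?P h Y) \<partial>?L) = (\<integral>\<^sup>+Y. (\<Prod>i<n. ennreal (h (Y i))) \<partial>?L)"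
      using h sp by (intro nn_integral_cong prod_ennreal[symmetric]) (auto simp: prob_density_def)
    also have "\<dots> = (\<Prod>i<n. \<integral>\<^sup>+x. ennreal (h x) \<partial>\<nu>)"
      using h by (intro nu.product_nn_integral_prod) (auto simp: prob_density_def)
    finally show ?thesis using h by (simp add: prob_density_def)
  qed
  let ?\<rho> = "1 - (hellinger \<nu> f g)\<^sup>2 / 2"
  have low: "1 - 1 / (4 * real n) \<le> ?\<rho>" using H by (simp add: field_simps)
  have "3 / 4 \<le> (1 + - (1 / (4 * real n))) ^ n"
    using Bernoulli_inequality[of "- (1 / (4 * real n))" n] n by (simp add: field_simps)
  also have "\<dots> \<le> ?\<rho> ^ n"
    using low n by (intro power_mono) (auto simp: field_simps)
  finally have "ennreal (3 / 4) \<le> ennreal (?\<rho> ^ n)" by (rule ennreal_leI)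
  also have "\<dots> = (\<Prod>i<n. \<integral>\<^sup>+x. ennreal (sqrt (f x * g x)) \<partial>\<nu>)"
  proof -
    have "1 / (4 * real n) \<le> 1" using n by simp
    then have "0 \<le> ?\<rho>" using low by linarith
    then show ?thesis unfolding hellinger_affinity[OF f g] by (simp add: ennreal_power)
  qed
  also have "\<dots> = (\<integral>\<^sup>+Y. (\<Prod>i<n. ennreal (sqrt (f (Y i) * g (Y i)))) \<partial>?L)"
    by (intro nu.product_nn_integral_prod[symmetric]) auto
  also have "\<dots> = (\<integral>\<^sup>+Y. ennreal (sqrt (?P f Y * ?P g Y)) \<partial>?L)"
  proof (rule nn_integral_cong)
    fix Y assume "Y \<in> space ?L"
    then have "0 \<le> sqrt (f (Y i) * g (Y i))" if "i < n" for i
      using nnf nng sp that by simp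
    moreover have "(\<Prod>i<n. sqrt (f (Y i) * g (Y i))) = sqrt (?P f Y * ?P g Y)" 
      by (induction n) (simp_all add: real_sqrt_mult)
    ultimately show "(\<Prod>i<n. ennreal (sqrt (f (Y i) * g (Y i)))) = ennreal (sqrt (?P f Y * ?P g Y))"
      by (subst prod_ennreal) auto
  qed
  also have "\<dots> \<le> (\<integral>\<^sup>+Y. ennreal (min (?P f Y) (?P g Y))
      + (ennreal (1/4) * ennreal (?P f Y) + ennreal (1/4) * ennreal (?P g Y)) \<partial>?L)"
  proof (rule nn_integral_mono)
    fix Y assume "Y \<in> space ?L"
    then have "0 \<le> ?P f Y" "0 \<le> ?P g Y"
      using nnf nng sp by (auto intro!: prod_nonneg)
    then show "ennreal (sqrt (?P f Y * ?P g Y)) \<le> ennreal (min (?P f Y) (?P g Y))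
      + (ennreal (1/4) * ennreal (?P f Y) + ennreal (1/4) * ennreal (?P g Y))"
      using sqrt_mult_le_min[of "?P f Y" "?P g Y"]
      by (simp flip: ennreal_mult ennreal_plus add: ennreal_leI add_divide_distrib)
  qed
  also have "\<dots> = (\<integral>\<^sup>+Y. ennreal (min (?P f Y) (?P g Y)) \<partial>?L) + ennreal (1 / 2)"
    using one[OF f] one[OF g] by (simp add: nn_integral_add nn_integral_cmult flip: ennreal_plus)
  finally have *: "ennreal (3 / 4) \<le> (\<integral>\<^sup>+Y. ennreal (min (?P f Y) (?P g Y)) \<partial>?L) + ennreal (1 / 2)" .
  show ?thesis
  proof (cases "(\<integral>\<^sup>+Y. ennreal (min (?P f Y) (?P g Y)) \<partial>?L)")
    case (real r)
    have eq: "ennreal (r + 1 / 2) = ennreal r + ennreal (1 / 2)"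
      using real(1) by (rule ennreal_plus) simp
    have "ennreal (3 / 4) \<le> ennreal (r + 1 / 2)" using * unfolding real(2) eq .
    then have "3 / 4 \<le> r + 1 / 2" by (subst (asm) ennreal_le_iff) (use real(1) in simp_all)
    then show ?thesis unfolding real(2) by (intro ennreal_leI) simp
  qed simp
qed

section \<open>Assouad's lemma for Hellinger loss\<close>

text \<open>
  The combinatorial heart of Assouad's method, for one fixed sample: \<open>P S\<close> is the likelihood of the
  vertex \<open>S\<close> and \<open>T\<close> the vertex that is guessed. Pair \<open>S\<close> with \<open>insert k S\<close>: the guess is wrong in
  coordinate \<open>k\<close> for exactly one of the two, so the pair costs at least the smaller likelihood. The
  left-hand side no longer depends on \<open>T\<close>, so that \<open>T\<close> may depend on the sample in any way,
  measurable or not.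
\<close>

lemma hamming_weighted_sum_ge:
  fixes P :: "nat set \<Rightarrow> real"
  assumes P: "\<And>S. S \<subseteq> {..<m} \<Longrightarrow> 0 \<le> P S" and T: "T \<subseteq> {..<m}"
  shows "(\<Sum>k<m. \<Sum>S\<in>Pow ({..<m} - {k}). min (P S) (P (insert k S)))
       \<le> (\<Sum>S\<in>Pow {..<m}. P S * real (card (sym_diff S T)))"
proof -
  let ?t = "\<lambda>k S. P S * of_bool ((k \<in> S) \<noteq> (k \<in> T))"
  have inner: "(\<Sum>S\<in>Pow ({..<m} - {k}). min (P S) (P (insert k S))) \<le> (\<Sum>S\<in>Pow {..<m}. ?t k S)"
    if k: "k < m" for k
  proof -
    let ?I = "{..<m} - {k}"
    have ins: "{..<m} = insert k ?I" using k by auto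
    have "(\<Sum>S\<in>Pow {..<m}. ?t k S) = (\<Sum>S\<in>Pow ?I. ?t k S) + (\<Sum>S\<in>insert k ` Pow ?I. ?t k S)"
      by (subst ins, subst Pow_insert, subst sum.union_disjoint) auto
    also have "(\<Sum>S\<in>insert k ` Pow ?I. ?t k S) = (\<Sum>S\<in>Pow ?I. ?t k (insert k S))"
      by (subst sum.reindex) (auto simp: inj_on_def)
    also have "(\<Sum>S\<in>Pow ?I. ?t k S) + \<dots> = (\<Sum>S\<in>Pow ?I. ?t k S + ?t k (insert k S))"
      by (simp add: sum.distrib)
    also have "\<dots> \<ge> (\<Sum>S\<in>Pow ?I. min (P S) (P (insert k S)))"
      by (intro sum_mono) auto
    finally show ?thesis .
  qed
  have card: "real (card (sym_diff S T)) = (\<Sum>k<m. of_bool ((k \<in> S) \<noteq> (k \<in> T)))"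
    if "S \<subseteq> {..<m}" for S
  proof -
    have "sym_diff S T = {k\<in>{..<m}. (k \<in> S) \<noteq> (k \<in> T)}" using that T by auto
    then show ?thesis by (simp add: of_bool_def sum.If_cases Int_def flip: sum.inter_filter)
  qed
  have "(\<Sum>k<m. \<Sum>S\<in>Pow ({..<m} - {k}). min (P S) (P (insert k S)))
      \<le> (\<Sum>k<m. \<Sum>S\<in>Pow {..<m}. ?t k S)"
    using inner by (intro sum_mono) auto
  also have "\<dots> = (\<Sum>S\<in>Pow {..<m}. \<Sum>k<m. ?t k S)" by (rule sum.swap)
  also have "\<dots> = (\<Sum>S\<in>Pow {..<m}. P S * real (card (sym_diff S T)))"
    by (intro sum.cong refl) (simp add: card sum_distrib_left)
  finally show ?thesis .
qed

text \<open>
  Assouad's lemma. The supremum over the class is at least the average over the \<open>2^m\<close> vertices of the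
  hypercube. The separation hypothesis turns Hellinger loss into Hamming loss, and the
  proximity hypothesis makes each of the \<open>m\<close> coordinates undecidable with constant probability.
\<close>

lemma assouad_minimax_risk:
  fixes G :: "nat set \<Rightarrow> real measure"
  assumes n: "0 < n" and \<delta>: "0 \<le> \<delta>"
    and cls: "\<And>S. S \<subseteq> {..<m} \<Longrightarrow> G S \<in> \<G>"
    and dens: "\<And>S. S \<subseteq> {..<m} \<Longrightarrow> prob_density lborel (gaussian_mixture (G S))"
    and sep: "\<And>S T. S \<subseteq> {..<m} \<Longrightarrow> T \<subseteq> {..<m} \<Longrightarrow> \<delta> * real (card (sym_diff S T))
        \<le> (hellinger lborel (gaussian_mixture (G S)) (gaussian_mixture (G T)))\<^sup>2"
    and near: "\<And>S k. S \<subseteq> {..<m} \<Longrightarrow> k < m \<Longrightarrow> k \<notin> S \<Longrightarrow>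
        (hellinger lborel (gaussian_mixture (G S)) (gaussian_mixture (G (insert k S))))\<^sup>2
          \<le> 1 / (2 * real n)"
  shows "ennreal (real m * \<delta> / 32) \<le> minimax_risk n \<G>"
  unfolding minimax_risk_def
proof (rule INF_greatest)
  fix fh assume fh: "fh \<in> density_estimators n"
  let ?L = "\<Pi>\<^sub>M i\<in>{..<n}. (lborel :: real measure)"
  define f where "f S = gaussian_mixture (G S)" for S
  define P where "P S Y = (\<Prod>i<n. f S (Y i))" for S Y
  define D where "D S Y = (hellinger lborel (f S) (fh Y))\<^sup>2" for S Y
  let ?risk = "\<lambda>S. \<integral>\<^sup>+Y. ennreal (D S Y) \<partial>sample_law n (G S)"
  let ?sup = "SUP G\<in>\<G>. \<integral>\<^sup>+Y. ennreal ((hellinger lborel (gaussian_mixture G) (fh Y))\<^sup>2) \<partial>sample_law n G"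
  let ?C = "Pow {..<m}"
  have setsL: "sets ?L = sets (\<Pi>\<^sub>M i\<in>{..<n}. (borel :: real measure))"
    by (intro sets_PiM_cong) auto
  have spL: "space ?L = space (\<Pi>\<^sub>M i\<in>{..<n}. (borel :: real measure))"
    by (rule sets_eq_imp_space_eq[OF setsL])
  have "(\<lambda>(Y, y). fh Y y) \<in> borel_measurable ((\<Pi>\<^sub>M i\<in>{..<n}. borel) \<Otimes>\<^sub>M borel)"
    using fh by (simp add: density_estimators_def)
  also have "borel_measurable ((\<Pi>\<^sub>M i\<in>{..<n}. borel) \<Otimes>\<^sub>M borel) = borel_measurable (?L \<Otimes>\<^sub>M (lborel :: real measure))"
    by (intro measurable_cong_sets refl sets_pair_measure_cong setsL[symmetric]) simp
  finally have fh_meas[measurable]: "(\<lambda>(Y, y). fh Y y) \<in> borel_measurable (?L \<Otimes>\<^sub>M lborel)" .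
  have fh_dens: "prob_density lborel (fh Y)" if "Y \<in> space ?L" for Y
    using fh that unfolding density_estimators_def spL by blast
  have dens': "prob_density lborel (f S)" if "S \<subseteq> {..<m}" for S
    using dens[OF that] by (simp add: f_def)
  have f_meas: "f S \<in> borel_measurable borel" and f_nn: "0 \<le> f S y" if "S \<subseteq> {..<m}" for S y
    using dens'[OF that] by (auto simp: prob_density_def)
  have P_nn: "0 \<le> P S Y" if "S \<subseteq> {..<m}" for S Y
    using f_nn[OF that] by (auto simp: P_def intro!: prod_nonneg)
  have P_meas: "P S \<in> borel_measurable ?L" if "S \<subseteq> {..<m}" for S
    using f_meas[OF that] unfolding P_def by measurable
  have D_nn: "0 \<le> D S Y" for S Y by (simp add: D_def)
  have D_meas: "D S \<in> borel_measurable ?L" if "S \<subseteq> {..<m}" for S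
  proof -
    have [measurable]: "f S \<in> borel_measurable borel" by (rule f_meas[OF that])
    show ?thesis unfolding D_def[abs_def] hellinger_sq
      by (intro lborel.borel_measurable_lebesgue_integral) measurable
  qed
  have risk: "?risk S = (\<integral>\<^sup>+Y. ennreal (P S Y * D S Y) \<partial>?L)" if S: "S \<subseteq> {..<m}" for S
  proof -
    have [measurable]: "f S \<in> borel_measurable borel" by (rule f_meas[OF S])
    have "sample_law n (G S) = density ?L (\<lambda>Y. \<Prod>i<n. ennreal (f S (Y i)))"
      unfolding sample_law_def f_def[symmetric]
      by (intro PiM_density_prob dens'[OF S] lborel.sigma_finite_measure_axioms) simp
    also have "\<dots> = density ?L (\<lambda>Y. ennreal (P S Y))"
      using f_nn[OF S] by (simp add: P_def prod_ennreal)
    finally show ?thesis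
      using D_meas[OF S] P_meas[OF S] P_nn[OF S] D_nn
      by (simp add: nn_integral_density ennreal_mult)
  qed
  \<comment> \<open>Whatever density the estimator returns, the hypercube vertex nearest to it already
    separates it from all others.\<close>
  have pointwise: "\<delta> / 4 * (\<Sum>k<m. \<Sum>S\<in>Pow ({..<m} - {k}). min (P S Y) (P (insert k S) Y))
      \<le> (\<Sum>S\<in>?C. P S Y * D S Y)" if Y: "Y \<in> space ?L" for Y
  proof -
    obtain T where "is_arg_min (\<lambda>S. D S Y) (\<lambda>S. S \<in> ?C) T"
      using ex_is_arg_min_if_finite[of ?C "\<lambda>S. D S Y"] by blast
    then have T: "T \<subseteq> {..<m}" and min: "\<And>S. S \<subseteq> {..<m} \<Longrightarrow> D T Y \<le> D S Y"
      by (auto simp: is_arg_min_linorder)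
    \<comment> \<open>since \<open>D T Y \<le> D S Y\<close>, the triangle inequality gives \<open>H\<^sup>2(f S, f T) \<le> 4 D S Y\<close>\<close>
    have D_ge: "\<delta> / 4 * real (card (sym_diff S T)) \<le> D S Y" if S: "S \<subseteq> {..<m}" for S
      using sep[OF S T] hellinger_sq_triangle[OF dens'[OF S] dens'[OF T] fh_dens[OF Y]] min[OF S]
      by (simp add: D_def f_def)
    have "\<delta> / 4 * (\<Sum>k<m. \<Sum>S\<in>Pow ({..<m} - {k}). min (P S Y) (P (insert k S) Y))
        \<le> \<delta> / 4 * (\<Sum>S\<in>?C. P S Y * real (card (sym_diff S T)))"
      using \<delta> by (intro mult_left_mono hamming_weighted_sum_ge P_nn T) auto
    also have "\<dots> = (\<Sum>S\<in>?C. P S Y * (\<delta> / 4 * real (card (sym_diff S T))))"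
      by (simp add: sum_distrib_left mult_ac)
    also have "\<dots> \<le> (\<Sum>S\<in>?C. P S Y * D S Y)"
      using P_nn D_ge by (intro sum_mono mult_left_mono) auto
    finally show ?thesis .
  qed
  have sub: "S \<subseteq> {..<m}" "insert k S \<subseteq> {..<m}" "k \<notin> S" if "k < m" "S \<in> Pow ({..<m} - {k})" for k S
    using that by auto
  have "ennreal (2 ^ m * (real m * \<delta> / 32))
      \<le> ennreal (\<delta> / 4) * (\<Sum>k<m. \<Sum>S\<in>Pow ({..<m} - {k}). ennreal (1 / 4))"
  proof -
    have "(\<Sum>k<m. \<Sum>S\<in>Pow ({..<m} - {k}). ennreal (1 / 4))
        = ennreal (\<Sum>k<m. \<Sum>S\<in>Pow ({..<m} - {k}). (1 / 4))"
      by (subst sum_ennreal[symmetric], simp add: sum_nonneg) (subst sum_ennreal, auto)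
    \<comment> \<open>half of the vertices omit \<open>k\<close>\<close>
    also have "(\<Sum>k<m. \<Sum>S\<in>Pow ({..<m} - {k}). (1 / 4 :: real)) = (\<Sum>k<m. 2 ^ m / 8)"
    proof (rule sum.cong[OF refl])
      fix k assume k: "k \<in> {..<m}"
      then obtain m' where "m = Suc m'" by (cases m) auto
      then show "(\<Sum>S\<in>Pow ({..<m} - {k}). (1 / 4 :: real)) = 2 ^ m / 8"
        using k by (simp add: card_Pow)
    qed
    finally show ?thesis using \<delta> by (simp flip: ennreal_mult add: field_simps)
  qed
  also have "\<dots> \<le> ennreal (\<delta> / 4) * (\<Sum>k<m. \<Sum>S\<in>Pow ({..<m} - {k}).
      \<integral>\<^sup>+Y. ennreal (min (P S Y) (P (insert k S) Y)) \<partial>?L)"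
    unfolding P_def using near sub
    by (intro mult_left_mono sum_mono integral_min_product_ge dens' lborel.sigma_finite_measure_axioms n)
       (auto simp: f_def)
  also have "\<dots> = (\<integral>\<^sup>+Y. ennreal (\<delta> / 4) *
      (\<Sum>k<m. \<Sum>S\<in>Pow ({..<m} - {k}). ennreal (min (P S Y) (P (insert k S) Y))) \<partial>?L)"
  proof -
    have m: "(\<lambda>Y. ennreal (min (P S Y) (P (insert k S) Y))) \<in> borel_measurable ?L"
      if "k < m" "S \<in> Pow ({..<m} - {k})" for k S
      using P_meas[OF sub(1)[OF that]] P_meas[OF sub(2)[OF that]] by measurable
    have inner: "(\<integral>\<^sup>+Y. (\<Sum>S\<in>Pow ({..<m} - {k}). ennreal (min (P S Y) (P (insert k S) Y))) \<partial>?L)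
        = (\<Sum>S\<in>Pow ({..<m} - {k}). \<integral>\<^sup>+Y. ennreal (min (P S Y) (P (insert k S) Y)) \<partial>?L)"
      if "k < m" for k
      by (rule nn_integral_sum) (rule m[OF that])
    have m': "(\<lambda>Y. \<Sum>S\<in>Pow ({..<m} - {k}). ennreal (min (P S Y) (P (insert k S) Y)))
        \<in> borel_measurable ?L" if "k < m" for k
      by (rule borel_measurable_sum) (rule m[OF that])
    have outer: "(\<integral>\<^sup>+Y. (\<Sum>k<m. \<Sum>S\<in>Pow ({..<m} - {k}). ennreal (min (P S Y) (P (insert k S) Y))) \<partial>?L)
        = (\<Sum>k<m. \<integral>\<^sup>+Y. (\<Sum>S\<in>Pow ({..<m} - {k}). ennreal (min (P S Y) (P (insert k S) Y))) \<partial>?L)"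
      by (rule nn_integral_sum) (rule m', simp)
    show ?thesis
    proof (subst nn_integral_cmult)
      show "(\<lambda>Y. \<Sum>k<m. \<Sum>S\<in>Pow ({..<m} - {k}). ennreal (min (P S Y) (P (insert k S) Y)))
          \<in> borel_measurable ?L"
        by (rule borel_measurable_sum) (rule m', simp)
    qed (simp add: outer inner)
  qed
  also have "\<dots> \<le> (\<integral>\<^sup>+Y. (\<Sum>S\<in>?C. ennreal (P S Y * D S Y)) \<partial>?L)"
  proof (rule nn_integral_mono)
    fix Y assume Y: "Y \<in> space ?L"
    have nn: "0 \<le> min (P S Y) (P (insert k S) Y)" if "k < m" "S \<in> Pow ({..<m} - {k})" for k S
      using P_nn sub[OF that] by simp
    have "(\<Sum>k<m. \<Sum>S\<in>Pow ({..<m} - {k}). ennreal (min (P S Y) (P (insert k S) Y)))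
        = ennreal (\<Sum>k<m. \<Sum>S\<in>Pow ({..<m} - {k}). min (P S Y) (P (insert k S) Y))"
    proof -
      have "(\<Sum>S\<in>Pow ({..<m} - {k}). ennreal (min (P S Y) (P (insert k S) Y)))
        = ennreal (\<Sum>S\<in>Pow ({..<m} - {k}). min (P S Y) (P (insert k S) Y))" if "k < m" for k
        using nn that by (intro sum_ennreal) auto
      then have "(\<Sum>k<m. \<Sum>S\<in>Pow ({..<m} - {k}). ennreal (min (P S Y) (P (insert k S) Y)))
        = (\<Sum>k<m. ennreal (\<Sum>S\<in>Pow ({..<m} - {k}). min (P S Y) (P (insert k S) Y)))"
        by (intro sum.cong refl) auto
      also have "\<dots> = ennreal (\<Sum>k<m. \<Sum>S\<in>Pow ({..<m} - {k}). min (P S Y) (P (insert k S) Y))"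
        using nn by (intro sum_ennreal sum_nonneg) auto
      finally show ?thesis .
    qed
    moreover have "(\<Sum>S\<in>?C. ennreal (P S Y * D S Y)) = ennreal (\<Sum>S\<in>?C. P S Y * D S Y)"
      using P_nn D_nn by (intro sum_ennreal) auto
    ultimately show "ennreal (\<delta> / 4) *
        (\<Sum>k<m. \<Sum>S\<in>Pow ({..<m} - {k}). ennreal (min (P S Y) (P (insert k S) Y)))
        \<le> (\<Sum>S\<in>?C. ennreal (P S Y * D S Y))"
      using pointwise[OF Y] \<delta> by (simp flip: ennreal_mult' add: ennreal_leI)
  qed
  also have "\<dots> = (\<Sum>S\<in>?C. ?risk S)"
    using P_meas D_meas by (subst nn_integral_sum) (auto simp: risk)
  also have "\<dots> \<le> (\<Sum>S\<in>?C. ?sup)"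
  proof (intro sum_mono)
    fix S assume "S \<in> ?C"
    then have "G S \<in> \<G>" by (simp add: cls)
    then show "?risk S \<le> ?sup" unfolding D_def f_def by (rule SUP_upper)
  qed
  also have "\<dots> = ennreal (2 ^ m) * ?sup"
    by (simp add: card_Pow flip: ennreal_power)
  finally have "ennreal (2 ^ m) * ennreal (real m * \<delta> / 32) \<le> ennreal (2 ^ m) * ?sup"
    by (subst (asm) ennreal_mult) (use \<delta> in auto)
  then show "ennreal (real m * \<delta> / 32) \<le> ?sup"
    by (subst (asm) ennreal_mult_le_mult_iff) auto
qed

section \<open>Inverting Gaussian convolution on exponential polynomials\<close>

lemma normal_exp_moment:
  "has_bochner_integral lborel (\<lambda>y. exp (t * y) * normal_density \<mu> 1 y) (exp (t * \<mu> + t\<^sup>2 / 2))"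
proof -
  have "exp (t * y) * normal_density \<mu> 1 y
      = exp (t * \<mu> + t\<^sup>2 / 2) * normal_density (\<mu> + t) 1 y" for y
    by (simp add: normal_density_def field_simps power2_eq_square flip: exp_add)
  moreover have "has_bochner_integral lborel
      (\<lambda>y. exp (t * \<mu> + t\<^sup>2 / 2) * normal_density (\<mu> + t) 1 y) (exp (t * \<mu> + t\<^sup>2 / 2) * 1)"
    by (intro has_bochner_integral_mult_right) (simp add: has_bochner_integral_iff)
  ultimately show ?thesis by simp
qed

definition lagrange_basis :: "(nat \<Rightarrow> real) \<Rightarrow> nat \<Rightarrow> nat \<Rightarrow> real poly" where
  "lagrange_basis z m j =
     smult (inverse (\<Prod>i\<in>{..m} - {j}. z j - z i)) (\<Prod>i\<in>{..m} - {j}. [:- z i, 1:])"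

lemma poly_lagrange_basis:
  assumes "inj_on z {..m}" "i \<le> m" "j \<le> m"
  shows "poly (lagrange_basis z m j) (z i) = of_bool (i = j)"
proof (cases "i = j")
  case True
  have "z j - z k \<noteq> 0" if "k \<in> {..m} - {j}" for k
    using assms that by (auto simp: inj_on_def)
  then have "(\<Prod>k\<in>{..m} - {j}. z j - z k) \<noteq> 0" by simp
  then show ?thesis using True by (simp add: lagrange_basis_def poly_prod)
next
  case False
  then have "(\<Prod>k\<in>{..m} - {j}. z i - z k) = 0" using assms by (auto intro!: bexI[of _ i])
  then show ?thesis using False by (simp add: lagrange_basis_def poly_prod)
qed

lemma degree_lagrange_basis: "j \<le> m \<Longrightarrow> degree (lagrange_basis z m j) \<le> m"
proof -
  assume "j \<le> m"
  have "degree (\<Prod>i\<in>{..m} - {j}. [:- z i, 1:]) \<le> sum (degree \<circ> (\<lambda>i. [:- z i, 1:])) ({..m} - {j})"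
    by (rule degree_prod_sum_le) simp
  also have "\<dots> = m" using \<open>j \<le> m\<close> by simp
  finally show ?thesis
    unfolding lagrange_basis_def using degree_smult_le order_trans by blast
qed

text \<open>
  Each linear factor maps the coefficient sequence \<open>c\<close> to \<open>c (k - 1) - z c k\<close>, which enlarges its
  maximum by a factor of at most \<open>1 + \<bar>z\<bar>\<close>.
\<close>

lemma coeff_prod_linear_le:
  fixes z :: "'b \<Rightarrow> real"
  assumes "finite I"
  shows "\<bar>coeff (\<Prod>i\<in>I. [:- z i, 1:]) k\<bar> \<le> (\<Prod>i\<in>I. 1 + \<bar>z i\<bar>)"
  using assms
proof (induction I arbitrary: k rule: finite_induct)
  case empty
  then show ?case by (simp add: coeff_1)
next
  case (insert i I)
  let ?p = "\<Prod>i\<in>I. [:- z i, 1:]" and ?M = "\<Prod>i\<in>I. 1 + \<bar>z i\<bar>"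
  have M: "0 \<le> ?M" by (intro prod_nonneg) simp
  have "\<bar>coeff (pCons 0 ?p) k\<bar> \<le> ?M"
    using insert.IH M by (cases k) auto
  moreover have "\<bar>- z i * coeff ?p k\<bar> \<le> \<bar>z i\<bar> * ?M"
    using insert.IH by (simp add: abs_mult mult_left_mono)
  ultimately have "\<bar>- z i * coeff ?p k + coeff (pCons 0 ?p) k\<bar> \<le> (1 + \<bar>z i\<bar>) * ?M"
    by (simp add: algebra_simps)
  moreover have "(\<Prod>i\<in>insert i I. [:- z i, 1:]) = smult (- z i) ?p + pCons 0 ?p"
    using insert.hyps by (simp del: mult_pCons_left add: mult_pCons_left)
  ultimately show ?case using insert.hyps by simp
qed

lemma prod_grid_distances:
  assumes "j \<le> m"
  shows "(\<Prod>i\<in>{..m} - {j}. \<bar>real j - real i\<bar>) = fact j * fact (m - j)"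
  using assms
proof (induction m rule: dec_induct)
  case base
  have "{..j} - {j} = {0..<j}" by auto
  moreover have "(\<Prod>i=0..<j. \<bar>real j - real i\<bar>) = (\<Prod>i=0..<j. real (j - i))"
    by (intro prod.cong) auto
  ultimately show ?case by (simp add: fact_prod_rev)
next
  case (step m)
  have "{..Suc m} - {j} = insert (Suc m) ({..m} - {j})" using step.hyps by auto
  then show ?case using step by (simp add: Suc_diff_le)
qed

text \<open>
  For nodes \<open>exp (\<beta> i)\<close> inside \<open>[1, e]\<close>: the numerator has coefficients at most \<open>(1 + e)\<^sup>m \<le> 4\<^sup>m\<close>. In the
  denominator the nodes are at least as far apart as their exponents \<open>\<beta> i\<close>, which gives
  \<open>\<beta>\<^sup>m j! (m - j)! \<ge> \<beta>\<^sup>m m! / 2\<^sup>m\<close>.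
\<close>

lemma coeff_lagrange_basis_exp_le:
  assumes \<beta>: "0 < \<beta>" "\<beta> * real m \<le> 1" and j: "j \<le> m"
  shows "\<bar>coeff (lagrange_basis (\<lambda>i. exp (\<beta> * real i)) m j) k\<bar> \<le> 8 ^ m / (\<beta> ^ m * fact m)"
proof -
  let ?z = "\<lambda>i. exp (\<beta> * real i)" and ?I = "{..m} - {j}"
  have card: "card ?I = m" using j by simp
  have num: "\<bar>coeff (\<Prod>i\<in>?I. [:- ?z i, 1:]) k\<bar> \<le> 4 ^ m"
  proof -
    have "1 + \<bar>?z i\<bar> \<le> 4" if "i \<in> ?I" for i
    proof -
      have "\<beta> * real i \<le> \<beta> * real m" using that \<beta> by (intro mult_left_mono) auto
      also note \<beta>(2)
      finally have "?z i \<le> exp 1" by (rule iffD2[OF exp_le_cancel_iff])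
      then show ?thesis unfolding abs_exp_cancel using exp_le by linarith
    qed
    then have "(\<Prod>i\<in>?I. 1 + \<bar>?z i\<bar>) \<le> (\<Prod>i\<in>?I. 4)" by (intro prod_mono) auto
    then show ?thesis using coeff_prod_linear_le[of ?I ?z k] card by simp
  qed
  have gap: "\<beta> * \<bar>real j - real i\<bar> \<le> \<bar>?z j - ?z i\<bar>" for i
  proof -
    have *: "b - a \<le> exp b - exp a" if "0 \<le> a" "a \<le> b" for a b :: real
    proof -
      have "b - a \<le> exp (b - a) - 1" using exp_ge_add_one_self[of "b - a"] by linarith
      also have "\<dots> \<le> exp a * (exp (b - a) - 1)"
        using that mult_right_mono[of 1 "exp a" "exp (b - a) - 1"] by simp
      also have "\<dots> = exp b - exp a" by (simp add: algebra_simps flip: exp_add)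
      finally show ?thesis .
    qed
    show ?thesis
      using *[of "\<beta> * real i" "\<beta> * real j"] *[of "\<beta> * real j" "\<beta> * real i"] \<beta>
      by (cases "i \<le> j") (auto simp: algebra_simps abs_if mult_left_mono)
  qed
  have "\<beta> ^ m * fact m \<le> 2 ^ m * (\<beta> ^ m * (fact j * fact (m - j)))"
  proof -
    have "fact m = fact j * fact (m - j) * real (m choose j)"
      using binomial_fact[OF j, where 'a=real] by simp
    also have "\<dots> \<le> fact j * fact (m - j) * 2 ^ m"
      using of_nat_mono[OF binomial_le_pow2[of m j], where 'a=real] by (intro mult_left_mono) simp_all
    finally show ?thesis using \<beta> by (simp add: mult_ac)
  qed
  also have "\<beta> ^ m * (fact j * fact (m - j)) = (\<Prod>i\<in>?I. \<beta> * \<bar>real j - real i\<bar>)"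
    using card by (simp add: prod.distrib prod_grid_distances[OF j])
  also have "\<dots> \<le> (\<Prod>i\<in>?I. \<bar>?z j - ?z i\<bar>)"
    using gap \<beta> by (intro prod_mono) auto
  also have "\<dots> = \<bar>\<Prod>i\<in>?I. ?z j - ?z i\<bar>" by (simp add: abs_prod)
  finally have den: "\<beta> ^ m * fact m / 2 ^ m \<le> \<bar>\<Prod>i\<in>?I. ?z j - ?z i\<bar>"
    by (simp add: field_simps)
  have pos: "0 < \<beta> ^ m * fact m / 2 ^ m" using \<beta> by simp
  have "\<bar>coeff (lagrange_basis ?z m j) k\<bar>
      = \<bar>coeff (\<Prod>i\<in>?I. [:- ?z i, 1:]) k\<bar> / \<bar>\<Prod>i\<in>?I. ?z j - ?z i\<bar>"
    by (simp add: lagrange_basis_def abs_mult field_simps)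
  also have "\<dots> \<le> 4 ^ m / (\<beta> ^ m * fact m / 2 ^ m)"
    using num den pos by (intro frac_le) auto
  also have "\<dots> = 8 ^ m / (\<beta> ^ m * fact m)"
    by (simp flip: power_mult_distrib)
  finally show ?thesis .
qed

text \<open>
  A function of the observation that turns convolution with the normal density into evaluation of
  \<open>p\<close>: since \<open>\<integral> exp (t y) \<phi>(y - x) dy = exp (t x + t\<^sup>2/2)\<close>, the monomial \<open>z\<^sup>k\<close> at \<open>z = exp (\<tau> x)\<close> is
  produced by \<open>exp (- (k \<tau>)\<^sup>2/2) exp (k \<tau> y)\<close>. Real exponentials are unbounded, but only their
  second moments under normal laws matter.
\<close>

definition gaussian_dual :: "real \<Rightarrow> nat \<Rightarrow> real poly \<Rightarrow> real \<Rightarrow> real" where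
  "gaussian_dual \<tau> m p y =
     (\<Sum>k\<le>m. coeff p k * exp (- (real k * \<tau>)\<^sup>2 / 2) * exp (real k * \<tau> * y))"

lemma borel_measurable_gaussian_dual[measurable]: "gaussian_dual \<tau> m p \<in> borel_measurable borel"
  unfolding gaussian_dual_def[abs_def] by measurable

lemma gaussian_dual_integral:
  assumes "degree p \<le> m"
  shows "has_bochner_integral lborel (\<lambda>y. gaussian_dual \<tau> m p y * normal_density x 1 y)
           (poly p (exp (\<tau> * x)))"
proof -
  have "has_bochner_integral lborel
      (\<lambda>y. \<Sum>k\<le>m. coeff p k * exp (- (real k * \<tau>)\<^sup>2 / 2) * (exp (real k * \<tau> * y) * normal_density x 1 y))
      (\<Sum>k\<le>m. coeff p k * exp (- (real k * \<tau>)\<^sup>2 / 2) * exp (real k * \<tau> * x + (real k * \<tau>)\<^sup>2 / 2))"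
    by (intro has_bochner_integral_sum has_bochner_integral_mult_right normal_exp_moment)
  moreover have "(\<Sum>k\<le>m. coeff p k * exp (- (real k * \<tau>)\<^sup>2 / 2) * exp (real k * \<tau> * x + (real k * \<tau>)\<^sup>2 / 2))
      = poly p (exp (\<tau> * x))"
  proof -
    have "poly p (exp (\<tau> * x)) = (\<Sum>k\<le>m. coeff p k * exp (\<tau> * x) ^ k)"
      unfolding poly_altdef using assms
      by (intro sum.mono_neutral_left) (auto simp: coeff_eq_0)
    moreover have "exp (- (real k * \<tau>)\<^sup>2 / 2) * exp (real k * \<tau> * x + (real k * \<tau>)\<^sup>2 / 2)
        = exp (\<tau> * x) ^ k" for k
      by (simp add: mult_ac flip: exp_add exp_of_nat_mult)
    ultimately show ?thesis by (simp add: mult.assoc)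
  qed
  ultimately show ?thesis
    by (simp add: gaussian_dual_def sum_distrib_right mult.assoc)
qed

text \<open>
  The second moment is an explicit double sum with terms \<open>c\<^sub>k c\<^sub>l exp (k l \<tau>\<^sup>2 + (k + l) \<tau> x)\<close>. So the
  price of inverting the convolution is the factor \<open>exp ((m \<tau>)\<^sup>2)\<close>, which stays exponential in \<open>m\<close> as long
  as \<open>\<tau>\<close> is of order \<open>1/sqrt m\<close>.
\<close>

lemma gaussian_dual_L2:
  assumes C: "\<And>k. \<bar>coeff p k\<bar> \<le> C" and \<tau>: "0 \<le> \<tau>" and x: "0 \<le> x" "\<tau> * x \<le> 1"
  shows "integrable lborel (\<lambda>y. (gaussian_dual \<tau> m p y)\<^sup>2 * normal_density x 1 y)"
    and "(\<integral>y. (gaussian_dual \<tau> m p y)\<^sup>2 * normal_density x 1 y \<partial>lborel)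
         \<le> ((real m + 1) * C)\<^sup>2 * exp ((real m * \<tau>)\<^sup>2 + 2 * real m)"
proof -
  let ?c = "\<lambda>k. coeff p k * exp (- (real k * \<tau>)\<^sup>2 / 2)"
  let ?v = "\<lambda>k l. ?c k * ?c l * exp ((real k + real l) * \<tau> * x + ((real k + real l) * \<tau>)\<^sup>2 / 2)"
  have "has_bochner_integral lborel
      (\<lambda>y. \<Sum>k\<le>m. \<Sum>l\<le>m. ?c k * ?c l * (exp ((real k + real l) * \<tau> * y) * normal_density x 1 y))
      (\<Sum>k\<le>m. \<Sum>l\<le>m. ?v k l)"
    by (intro has_bochner_integral_sum has_bochner_integral_mult_right normal_exp_moment)
  moreover have "(\<Sum>k\<le>m. \<Sum>l\<le>m. ?c k * ?c l * (exp ((real k + real l) * \<tau> * y) * normal_density x 1 y))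
      = (gaussian_dual \<tau> m p y)\<^sup>2 * normal_density x 1 y" for y
  proof -
    define t where "t k = ?c k * exp (real k * \<tau> * y)" for k
    have "(gaussian_dual \<tau> m p y)\<^sup>2 * normal_density x 1 y
        = (\<Sum>k\<le>m. \<Sum>l\<le>m. t k * t l) * normal_density x 1 y"
      by (simp add: gaussian_dual_def t_def power2_eq_square sum_product)
    also have "\<dots> = (\<Sum>k\<le>m. \<Sum>l\<le>m. t k * t l * normal_density x 1 y)"
      by (simp add: sum_distrib_right)
    also have "\<dots> = (\<Sum>k\<le>m. \<Sum>l\<le>m. ?c k * ?c l * (exp ((real k + real l) * \<tau> * y) * normal_density x 1 y))"
      by (intro sum.cong refl) (simp add: t_def distrib_right exp_add)
    finally show ?thesis ..
  qed
  ultimately have I: "has_bochner_integral lborel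
      (\<lambda>y. (gaussian_dual \<tau> m p y)\<^sup>2 * normal_density x 1 y) (\<Sum>k\<le>m. \<Sum>l\<le>m. ?v k l)"
    by simp
  have v: "?v k l \<le> C\<^sup>2 * exp ((real m * \<tau>)\<^sup>2 + 2 * real m)" if "k \<le> m" "l \<le> m" for k l
  proof -
    have "?v k l = coeff p k * coeff p l * exp ((real k * \<tau>) * (real l * \<tau>) + (real k + real l) * (\<tau> * x))"
      by (simp add: mult_exp_exp power2_eq_square field_simps)
    also have "\<dots> \<le> C\<^sup>2 * exp ((real k * \<tau>) * (real l * \<tau>) + (real k + real l) * (\<tau> * x))"
    proof (intro mult_right_mono)
      have "0 \<le> C" using C[of 0] by linarith
      then have "\<bar>coeff p k\<bar> * \<bar>coeff p l\<bar> \<le> C * C" by (intro mult_mono C) auto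
      then show "coeff p k * coeff p l \<le> C\<^sup>2"
        by (simp add: power2_eq_square flip: abs_mult)
    qed simp
    also have "\<dots> \<le> C\<^sup>2 * exp ((real m * \<tau>) * (real m * \<tau>) + (real m + real m) * 1)"
      using that \<tau> x by (intro mult_left_mono iffD2[OF exp_le_cancel_iff] add_mono mult_mono) auto
    finally show ?thesis by (simp add: power2_eq_square)
  qed
  show "integrable lborel (\<lambda>y. (gaussian_dual \<tau> m p y)\<^sup>2 * normal_density x 1 y)"
    using I unfolding has_bochner_integral_iff by blast
  have "(\<integral>y. (gaussian_dual \<tau> m p y)\<^sup>2 * normal_density x 1 y \<partial>lborel) = (\<Sum>k\<le>m. \<Sum>l\<le>m. ?v k l)"
    using I by (rule has_bochner_integral_integral_eq)
  also have "\<dots> \<le> (\<Sum>k\<le>m. \<Sum>l\<le>m. C\<^sup>2 * exp ((real m * \<tau>)\<^sup>2 + 2 * real m))"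
    using v by (intro sum_mono) auto
  also have "\<dots> = ((real m + 1) * C)\<^sup>2 * exp ((real m * \<tau>)\<^sup>2 + 2 * real m)"
    by (simp add: power2_eq_square algebra_simps)
  finally show "(\<integral>y. (gaussian_dual \<tau> m p y)\<^sup>2 * normal_density x 1 y \<partial>lborel)
         \<le> ((real m + 1) * C)\<^sup>2 * exp ((real m * \<tau>)\<^sup>2 + 2 * real m)" .
qed

section \<open>A weighted Cauchy-Schwarz inequality and Gram-Schmidt\<close>

text \<open>
  Integrating \<open>2 \<bar>a \<psi>\<bar> \<le> l a\<^sup>2 w + \<psi>\<^sup>2/(w l)\<close> and optimising over \<open>l > 0\<close>.
\<close>

lemma weighted_cauchy_schwarz:
  fixes a \<psi> w :: "'a \<Rightarrow> real"
  assumes w: "\<And>x. 0 < w x" and A: "0 < A"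
    and ia: "integrable M (\<lambda>x. (a x)\<^sup>2 * w x)" "(\<integral>x. (a x)\<^sup>2 * w x \<partial>M) \<le> A"
    and i\<psi>: "integrable M (\<lambda>x. (\<psi> x)\<^sup>2 / w x)" and m: "(\<lambda>x. a x * \<psi> x) \<in> borel_measurable M"
  shows "(\<integral>x. a x * \<psi> x \<partial>M)\<^sup>2 \<le> A * (\<integral>x. (\<psi> x)\<^sup>2 / w x \<partial>M)"
proof -
  let ?q = "\<bar>\<integral>x. a x * \<psi> x \<partial>M\<bar>" and ?B = "\<integral>x. (\<psi> x)\<^sup>2 / w x \<partial>M"
  have amgm: "2 * \<bar>a x * \<psi> x\<bar> \<le> l * ((a x)\<^sup>2 * w x) + (\<psi> x)\<^sup>2 / w x / l" if l: "0 < l" for l x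
  proof -
    have "0 \<le> (l * w x * \<bar>a x\<bar> - \<bar>\<psi> x\<bar>)\<^sup>2 / (l * w x)" using l w[of x] by simp
    also have "\<dots> = l * ((a x)\<^sup>2 * w x) + (\<psi> x)\<^sup>2 / w x / l - 2 * \<bar>a x * \<psi> x\<bar>"
      using l w[of x] by (simp add: power2_diff power_mult_distrib abs_mult field_simps power2_eq_square)
    finally show ?thesis by simp
  qed
  have int: "integrable M (\<lambda>x. a x * \<psi> x)"
  proof (rule Bochner_Integration.integrable_bound)
    show "integrable M (\<lambda>x. 1 * ((a x)\<^sup>2 * w x) + (\<psi> x)\<^sup>2 / w x / 1)" using ia i\<psi> by simp
    show "AE x in M. norm (a x * \<psi> x) \<le> norm (1 * ((a x)\<^sup>2 * w x) + (\<psi> x)\<^sup>2 / w x / 1)"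
    proof (rule AE_I2)
      fix x
      let ?R = "1 * ((a x)\<^sup>2 * w x) + (\<psi> x)\<^sup>2 / w x / 1"
      have "\<bar>a x * \<psi> x\<bar> \<le> ?R"
        using amgm[of 1 x] abs_ge_zero[of "a x * \<psi> x"] by linarith
      also have "?R \<le> \<bar>?R\<bar>" by (rule abs_ge_self)
      finally show "norm (a x * \<psi> x) \<le> norm ?R" unfolding real_norm_def .
    qed
  qed (rule m)
  have *: "2 * ?q \<le> l * A + ?B / l" if l: "0 < l" for l
  proof -
    have "2 * ?q \<le> 2 * (\<integral>x. \<bar>a x * \<psi> x\<bar> \<partial>M)"
      using integral_abs_bound[of M "\<lambda>x. a x * \<psi> x"] by simp
    also have "\<dots> = (\<integral>x. 2 * \<bar>a x * \<psi> x\<bar> \<partial>M)" by simp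
    also have "\<dots> \<le> (\<integral>x. l * ((a x)\<^sup>2 * w x) + (\<psi> x)\<^sup>2 / w x / l \<partial>M)"
      by (intro integral_mono amgm[OF l] Bochner_Integration.integrable_add integrable_mult_right
          integrable_divide integrable_abs ia i\<psi> int)
    also have "\<dots> = l * (\<integral>x. (a x)\<^sup>2 * w x \<partial>M) + ?B / l"
      by (subst Bochner_Integration.integral_add)
        (simp_all only: integrable_mult_right integrable_divide ia i\<psi> integral_mult_right_zero
          integral_divide_zero)
    also have "\<dots> \<le> l * A + ?B / l" using ia l by simp
    finally show ?thesis .
  qed
  show ?thesis
  proof (cases "?q = 0")
    case True
    have "0 \<le> ?B" using w by (intro integral_nonneg_AE AE_I2) (simp add: less_imp_le)
    then show ?thesis using True A by simp
  next
    case False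
    then have q: "0 < ?q" by simp
    \<comment> \<open>the optimal choice is \<open>l = \<bar>q\<bar>/A\<close>\<close>
    have "?q \<le> A * ?B / ?q"
      using *[of "?q / A"] q A by (simp add: field_simps)
    then have "?q * ?q \<le> A * ?B" using q by (simp add: field_simps)
    then show ?thesis by (simp add: power2_eq_square flip: abs_mult)
  qed
qed

lemma linear_form_sum:
  fixes B :: "(nat \<Rightarrow> real) \<Rightarrow> (nat \<Rightarrow> real) \<Rightarrow> real"
  assumes lin: "\<And>a b d t. B (\<lambda>j. a j + t * b j) d = B a d + t * B b d" and "finite K"
  shows "B (\<lambda>j. a j + (\<Sum>k\<in>K. e k * Q k j)) d = B a d + (\<Sum>k\<in>K. e k * B (Q k) d)"
  using \<open>finite K\<close>
proof (induction K rule: finite_induct)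
  case (insert k K)
  have "B (\<lambda>j. a j + (\<Sum>k\<in>insert k K. e k * Q k j)) d
      = B (\<lambda>j. (a j + (\<Sum>k\<in>K. e k * Q k j)) + e k * Q k j) d"
    using insert.hyps by (simp add: algebra_simps)
  also have "\<dots> = B (\<lambda>j. a j + (\<Sum>k\<in>K. e k * Q k j)) d + e k * B (Q k) d" by (rule lin)
  finally show ?case using insert by simp
qed simp

text \<open>
  Gram-Schmidt orthonormalisation of the unit vectors of \<open>\<real>\<^sup>m\<close>, for a bilinear form \<open>B\<close> on coefficient
  sequences that is positive on every sequence with a nonzero entry among the first \<open>m\<close>. Here
  \<open>Q k\<close> lists the coefficients of the \<open>k\<close>-th orthonormal vector.
\<close>

lemma gram_schmidt_coefficients:
  fixes B :: "(nat \<Rightarrow> real) \<Rightarrow> (nat \<Rightarrow> real) \<Rightarrow> real"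
  assumes lin: "\<And>a b d t. B (\<lambda>j. a j + t * b j) d = B a d + t * B b d"
    and sym: "\<And>a b. B a b = B b a"
    and pos: "\<And>c j. j < m \<Longrightarrow> c j \<noteq> 0 \<Longrightarrow> 0 < B c c"
  obtains Q where "\<And>k l. k < m \<Longrightarrow> l < m \<Longrightarrow> B (Q k) (Q l) = of_bool (k = l)"
proof -
  \<comment> \<open>the support condition keeps the new vector nonzero: its coefficient at \<open>r\<close> remains \<open>1\<close>\<close>
  have "\<exists>Q. (\<forall>k<r. \<forall>l<r. B (Q k) (Q l) = of_bool (k = l)) \<and> (\<forall>k<r. \<forall>j\<ge>r. Q k j = 0)"
    if "r \<le> m" for r
    using that
  proof (induction r)
    case (Suc r)
    then obtain Q where Q: "(\<forall>k<r. \<forall>l<r. B (Q k) (Q l) = of_bool (k = l)) \<and> (\<forall>k<r. \<forall>j\<ge>r. Q k j = 0)"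
      using Suc_leD by blast
    then have on: "\<And>k l. k < r \<Longrightarrow> l < r \<Longrightarrow> B (Q k) (Q l) = of_bool (k = l)"
      and supp: "\<And>k j. k < r \<Longrightarrow> r \<le> j \<Longrightarrow> Q k j = 0"
      by blast+
    define u :: "nat \<Rightarrow> real" where "u j = of_bool (j = r)" for j
    define v where "v j = u j + (\<Sum>k<r. - B u (Q k) * Q k j)" for j
    have vr: "v r = 1" and vj: "v j = 0" if "Suc r \<le> j" for j
      using supp that by (simp_all add: v_def u_def)
    have Bv: "B v d = B u d + (\<Sum>k<r. - B u (Q k) * B (Q k) d)" for d
      unfolding v_def by (rule linear_form_sum[OF lin]) simp
    have orth: "B v (Q l) = 0" if "l < r" for l
    proof -
      have "(\<Sum>k<r. - B u (Q k) * B (Q k) (Q l)) = (\<Sum>k<r. if k = l then - B u (Q l) else 0)"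
        using on that by (intro sum.cong) auto
      then show ?thesis using that by (simp add: Bv)
    qed
    have vv: "0 < B v v" using pos[of r v] vr Suc.prems by simp
    have scale: "B (\<lambda>j. t * v j) d = t * B v d" for t d
    proof -
      have zero: "B (\<lambda>j. 0) d = 0" using lin[of "\<lambda>j. 0" 1 "\<lambda>j. 0" d] by simp
      show ?thesis using lin[of "\<lambda>j. 0" t v d] zero by simp
    qed
    let ?t = "1 / sqrt (B v v)"
    define Q' where "Q' k = (if k = r then (\<lambda>j. ?t * v j) else Q k)" for k
    have "B (Q' k) (Q' l) = of_bool (k = l)" if "k < Suc r" "l < Suc r" for k l
    proof -
      have "B (\<lambda>j. ?t * v j) (\<lambda>j. ?t * v j) = ?t * (?t * B v v)"
        by (simp only: scale[of ?t "\<lambda>j. ?t * v j"] sym[of v "\<lambda>j. ?t * v j"] scale[of ?t v])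
      also have "\<dots> = 1" using vv by simp
      finally have rr: "B (\<lambda>j. ?t * v j) (\<lambda>j. ?t * v j) = 1" .
      have rl: "B (\<lambda>j. ?t * v j) (Q i) = 0" if "i < r" for i
        unfolding scale orth[OF that] by simp
      have lr: "B (Q i) (\<lambda>j. ?t * v j) = 0" if "i < r" for i
        using rl[OF that] by (subst sym)
      show ?thesis
        using that on rr rl lr unfolding Q'_def less_Suc_eq by (elim disjE) simp_all
    qed
    moreover have "Q' k j = 0" if "k < Suc r" "Suc r \<le> j" for k j
      using that supp vj by (auto simp: Q'_def)
    ultimately show ?case by blast
  qed simp
  then obtain Q where "\<forall>k<m. \<forall>l<m. B (Q k) (Q l) = of_bool (k = l)" by blast
  then show thesis by (intro that[of Q]) blast
qed

section \<open>Finite Gaussian mixtures\<close>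

definition atomic_prior :: "nat \<Rightarrow> (nat \<Rightarrow> real) \<Rightarrow> (nat \<Rightarrow> real) \<Rightarrow> real measure" where
  "atomic_prior m x p = distr (point_measure {..m} (\<lambda>j. ennreal (p j))) borel x"

definition mixture :: "nat \<Rightarrow> (nat \<Rightarrow> real) \<Rightarrow> (nat \<Rightarrow> real) \<Rightarrow> real \<Rightarrow> real" where
  "mixture m x p y = (\<Sum>j\<le>m. p j * normal_density (x j) 1 y)"

lemma borel_measurable_mixture[measurable]: "mixture m x p \<in> borel_measurable borel"
  unfolding mixture_def[abs_def] by measurable

lemma measure_atomic_prior:
  assumes p: "\<And>j. j \<le> m \<Longrightarrow> 0 \<le> p j" and A: "A \<in> sets borel"
  shows "measure (atomic_prior m x p) A = (\<Sum>j | j \<le> m \<and> x j \<in> A. p j)"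
proof -
  have "measure (atomic_prior m x p) A = measure (point_measure {..m} (\<lambda>j. ennreal (p j))) (x -` A \<inter> {..m})"
    unfolding atomic_prior_def using A by (subst measure_distr) (auto simp: space_point_measure)
  also have "\<dots> = (\<Sum>j\<in>x -` A \<inter> {..m}. p j)"
  proof -
    have "(\<Sum>j\<in>x -` A \<inter> {..m}. ennreal (p j)) = ennreal (\<Sum>j\<in>x -` A \<inter> {..m}. p j)"
      using p by (intro sum_ennreal) auto
    moreover have "0 \<le> (\<Sum>j\<in>x -` A \<inter> {..m}. p j)" using p by (intro sum_nonneg) auto
    ultimately show ?thesis by (simp add: measure_def emeasure_point_measure_finite)
  qed
  also have "x -` A \<inter> {..m} = {j. j \<le> m \<and> x j \<in> A}" by auto
  finally show ?thesis .
qed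

lemma atomic_prior_in_priors:
  assumes p: "\<And>j. j \<le> m \<Longrightarrow> 0 \<le> p j" and s: "(\<Sum>j\<le>m. p j) = 1"
  shows "atomic_prior m x p \<in> priors"
proof -
  have "prob_space (point_measure {..m} (\<lambda>j. ennreal (p j)))"
  proof (rule prob_spaceI)
    have "(\<Sum>j\<le>m. ennreal (p j)) = ennreal (\<Sum>j\<le>m. p j)"
      using p by (intro sum_ennreal) auto
    then show "emeasure (point_measure {..m} (\<lambda>j. ennreal (p j)))
        (space (point_measure {..m} (\<lambda>j. ennreal (p j)))) = 1"
      by (simp add: space_point_measure emeasure_point_measure_finite s)
  qed
  then have "prob_space (atomic_prior m x p)"
    unfolding atomic_prior_def by (rule prob_space.prob_space_distr) simp
  then show ?thesis by (simp add: priors_def atomic_prior_def)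
qed

lemma gaussian_mixture_atomic_prior:
  assumes p: "\<And>j. j \<le> m \<Longrightarrow> 0 \<le> p j"
  shows "gaussian_mixture (atomic_prior m x p) = mixture m x p"
proof
  fix y
  have "gaussian_mixture (atomic_prior m x p) y
      = (\<integral>j. std_normal_density (y - x j) \<partial>point_measure {..m} (\<lambda>j. ennreal (p j)))"
    unfolding gaussian_mixture_def atomic_prior_def by (subst integral_distr) auto
  also have "\<dots> = (\<Sum>j\<le>m. p j * std_normal_density (y - x j))"
    using p by (subst lebesgue_integral_point_measure_finite) auto
  finally show "gaussian_mixture (atomic_prior m x p) y = mixture m x p y"
    by (simp add: mixture_def normal_density_def)
qed

lemma has_bochner_integral_mixture:
  "has_bochner_integral lborel (mixture m x p) (\<Sum>j\<le>m. p j)"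
proof -
  have "has_bochner_integral lborel (\<lambda>y. \<Sum>j\<le>m. p j * normal_density (x j) 1 y) (\<Sum>j\<le>m. p j * 1)"
    by (intro has_bochner_integral_sum has_bochner_integral_mult_right) (simp add: has_bochner_integral_iff)
  then show ?thesis by (simp add: mixture_def[abs_def])
qed

lemma prob_density_mixture:
  assumes p: "\<And>j. j \<le> m \<Longrightarrow> 0 \<le> p j" and s: "(\<Sum>j\<le>m. p j) = 1"
  shows "prob_density lborel (mixture m x p)"
proof -
  have nn: "0 \<le> mixture m x p y" for y
    using p unfolding mixture_def by (intro sum_nonneg) auto
  have "(\<integral>\<^sup>+y. ennreal (mixture m x p y) \<partial>lborel) = ennreal 1"
    using has_bochner_integral_mixture[of m x p] nn s
    by (subst nn_integral_eq_integral) (auto simp: has_bochner_integral_iff)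
  then show ?thesis using nn by (simp add: prob_density_def)
qed

lemma mixture_pos:
  assumes "\<And>j. j \<le> m \<Longrightarrow> 0 < w j"
  shows "0 < mixture m x w y"
  unfolding mixture_def using assms by (intro sum_pos) (auto simp: normal_density_pos)

lemma mixture_mono:
  assumes "\<And>j. j \<le> m \<Longrightarrow> p j \<le> q j"
  shows "mixture m x p y \<le> mixture m x q y"
  unfolding mixture_def using assms by (intro sum_mono mult_right_mono) auto

lemma mixture_scale: "mixture m x (\<lambda>j. t * p j) y = t * mixture m x p y"
  by (simp add: mixture_def sum_distrib_left mult.assoc)

section \<open>Perturbations of a mixture and their chi-square geometry\<close>

text \<open>
  Moving mass \<open>c j\<close> from the atom \<open>x 0\<close> to the atom \<open>x (j + 1)\<close>, for each \<open>j < m\<close>, keeps the total mass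
  and changes the mixture density by a combination of these contrasts.
\<close>

definition node_contrast :: "(nat \<Rightarrow> real) \<Rightarrow> nat \<Rightarrow> real \<Rightarrow> real" where
  "node_contrast x j y = normal_density (x (Suc j)) 1 y - normal_density (x 0) 1 y"

definition perturbation :: "nat \<Rightarrow> (nat \<Rightarrow> real) \<Rightarrow> (nat \<Rightarrow> real) \<Rightarrow> real \<Rightarrow> real" where
  "perturbation m x c y = (\<Sum>j<m. c j * node_contrast x j y)"

definition move_mass :: "nat \<Rightarrow> (nat \<Rightarrow> real) \<Rightarrow> (nat \<Rightarrow> real) \<Rightarrow> nat \<Rightarrow> real" where
  "move_mass m w c i = (case i of 0 \<Rightarrow> w 0 - (\<Sum>j<m. c j) | Suc j \<Rightarrow> w (Suc j) + c j)"

text \<open>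
  The inner product of \<open>L\<^sup>2(1/f)\<close>, with \<open>f\<close> the mixture with weights \<open>w\<close>, pulled back to the coefficients
  of two perturbations. On the diagonal it is the chi-square divergence from \<open>f\<close> of the perturbed
  density.
\<close>

definition chi2_form ::
    "nat \<Rightarrow> (nat \<Rightarrow> real) \<Rightarrow> (nat \<Rightarrow> real) \<Rightarrow> (nat \<Rightarrow> real) \<Rightarrow> (nat \<Rightarrow> real) \<Rightarrow> real" where
  "chi2_form m x w c d =
     (\<integral>y. perturbation m x c y * perturbation m x d y / mixture m x w y \<partial>lborel)"

lemma borel_measurable_perturbation[measurable]: "perturbation m x c \<in> borel_measurable borel"
  unfolding perturbation_def[abs_def] node_contrast_def by measurable

lemma integrable_perturbation: "integrable lborel (perturbation m x c)"
  unfolding perturbation_def[abs_def] node_contrast_def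
  by (intro Bochner_Integration.integrable_sum integrable_mult_right Bochner_Integration.integrable_diff
      integrable_normal_density) simp_all

lemma sum_move_mass: "(\<Sum>i\<le>m. move_mass m w c i) = (\<Sum>i\<le>m. w i)"
  by (simp add: sum.atMost_shift move_mass_def sum.distrib)

lemma mixture_move_mass:
  "mixture m x (move_mass m w c) y = mixture m x w y + perturbation m x c y"
  by (simp add: mixture_def perturbation_def node_contrast_def sum.atMost_shift move_mass_def
      algebra_simps sum.distrib sum_subtractf) (simp add: sum_distrib_right)

lemma perturbation_linear:
  "perturbation m x (\<lambda>j. a j + t * b j) y = perturbation m x a y + t * perturbation m x b y"
  by (simp add: perturbation_def algebra_simps sum.distrib sum_distrib_left)

text \<open>
  Each component of a mixture is bounded by the mixture divided by its weight. This makes the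
  chi-square form finite.
\<close>

lemma perturbation_bounded:
  assumes w: "\<And>j. j \<le> m \<Longrightarrow> 0 < w j"
  obtains K where "\<And>y. \<bar>perturbation m x c y\<bar> \<le> K * mixture m x w y"
proof
  fix y
  let ?f = "mixture m x w y" and ?g = "\<lambda>i. normal_density (x i) 1 y"
  have g: "?g i \<le> 1 / w i * ?f" if i: "i \<le> m" for i
  proof -
    have "w i * ?g i \<le> ?f"
      unfolding mixture_def using w i
      by (intro member_le_sum[where f="\<lambda>j. w j * ?g j"]) (auto intro!: mult_nonneg_nonneg intro: less_imp_le)
    then show ?thesis using w[OF i] by (simp add: field_simps)
  qed
  have "\<bar>perturbation m x c y\<bar> \<le> (\<Sum>j<m. \<bar>c j\<bar> * ((1 / w (Suc j) + 1 / w 0) * ?f))"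
    unfolding perturbation_def
  proof (intro order.trans[OF sum_abs] sum_mono)
    fix j assume "j \<in> {..<m}"
    then have "?g (Suc j) \<le> 1 / w (Suc j) * ?f" by (intro g) simp
    moreover have "?g 0 \<le> 1 / w 0 * ?f" by (rule g) simp
    moreover have "\<bar>node_contrast x j y\<bar> \<le> ?g (Suc j) + ?g 0"
      unfolding node_contrast_def by (simp add: abs_le_iff add_increasing add_increasing2)
    ultimately have "\<bar>node_contrast x j y\<bar> \<le> (1 / w (Suc j) + 1 / w 0) * ?f"
      by (simp only: distrib_right)
    then show "\<bar>c j * node_contrast x j y\<bar> \<le> \<bar>c j\<bar> * ((1 / w (Suc j) + 1 / w 0) * ?f)"
      unfolding abs_mult by (intro mult_left_mono) auto
  qed
  then show "\<bar>perturbation m x c y\<bar> \<le> (\<Sum>j<m. \<bar>c j\<bar> * (1 / w (Suc j) + 1 / w 0)) * ?f"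
    by (simp add: sum_distrib_right mult.assoc)
qed

lemma integrable_chi2:
  assumes w: "\<And>j. j \<le> m \<Longrightarrow> 0 < w j"
  shows "integrable lborel (\<lambda>y. perturbation m x c y * perturbation m x d y / mixture m x w y)"
proof -
  obtain K where K: "\<And>y. \<bar>perturbation m x c y\<bar> \<le> K * mixture m x w y"
    using perturbation_bounded[of m w x c, OF w] by blast
  show ?thesis
  proof (rule Bochner_Integration.integrable_bound)
    show "integrable lborel (\<lambda>y. K * perturbation m x d y)"
      by (intro integrable_mult_right integrable_perturbation)
    show "AE y in lborel. norm (perturbation m x c y * perturbation m x d y / mixture m x w y)
        \<le> norm (K * perturbation m x d y)"
    proof (rule AE_I2)
      fix y
      have f: "0 < mixture m x w y" by (rule mixture_pos[OF w])
      have "\<bar>perturbation m x c y\<bar> / mixture m x w y \<le> \<bar>K\<bar>"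
        unfolding pos_divide_le_eq[OF f]
        using K[of y] mult_right_mono[OF abs_ge_self[of K] less_imp_le[OF f]] by (rule order.trans)
      then have "\<bar>perturbation m x c y\<bar> / mixture m x w y * \<bar>perturbation m x d y\<bar>
          \<le> \<bar>K\<bar> * \<bar>perturbation m x d y\<bar>" by (intro mult_right_mono) auto
      then show "norm (perturbation m x c y * perturbation m x d y / mixture m x w y)
          \<le> norm (K * perturbation m x d y)"
        using f by (simp add: abs_mult)
    qed
  qed measurable
qed

lemma chi2_form_sym: "chi2_form m x w c d = chi2_form m x w d c"
  unfolding chi2_form_def by (simp add: mult.commute)

lemma chi2_form_linear:
  assumes w: "\<And>j. j \<le> m \<Longrightarrow> 0 < w j"
  shows "chi2_form m x w (\<lambda>j. a j + t * b j) d = chi2_form m x w a d + t * chi2_form m x w b d"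
proof -
  have "perturbation m x (\<lambda>j. a j + t * b j) y * perturbation m x d y / mixture m x w y
      = perturbation m x a y * perturbation m x d y / mixture m x w y
        + t * (perturbation m x b y * perturbation m x d y / mixture m x w y)" for y
    by (simp add: perturbation_linear add_divide_distrib distrib_right)
  then show ?thesis
    unfolding chi2_form_def using integrable_chi2[OF w]
    by (simp only: Bochner_Integration.integral_add integrable_mult_right integral_mult_right_zero)
qed

text \<open>
  The \<open>L\<^sup>2(f)\<close> norm bound of the dual functions for the grid \<open>0, b, \<dots>, m b\<close> and the rate \<open>\<tau>\<close>; the middle
  factor bounds the Lagrange coefficients.
\<close>

definition grid_bound :: "nat \<Rightarrow> real \<Rightarrow> real \<Rightarrow> real" where
  "grid_bound m b \<tau> = (real m + 1) * (8 ^ m / ((\<tau> * b) ^ m * fact m)) * exp (((real m * \<tau>)\<^sup>2 + 2 * real m) / 2)"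

text \<open>
  The quantitative form of identifiability. The dual function of the Lagrange polynomial for the node
  \<open>x (j + 1)\<close> integrates to \<open>c j\<close> against the perturbation with coefficients \<open>c\<close>, because it integrates to
  \<open>0\<close> against all other components, among them the one at \<open>x 0\<close> that loses mass. The
  Cauchy-Schwarz inequality then bounds \<open>c j\<close> by the \<open>L\<^sup>2(1/f)\<close> norm of the perturbation, up to
  the \<open>L\<^sup>2(f)\<close> norm of the dual function. In particular the chi-square form is positive definite.
\<close>

lemma grid_coefficient_bound:
  fixes b \<tau> :: real
  defines "x \<equiv> \<lambda>i. b * real i"
  assumes b: "0 < b" and \<tau>: "0 < \<tau>" and range: "\<tau> * b * real m \<le> 1"
    and w: "\<And>j. j \<le> m \<Longrightarrow> 0 < w j" "(\<Sum>j\<le>m. w j) = 1" and j: "j < m"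
  shows "(c j)\<^sup>2 \<le> (grid_bound m b \<tau>)\<^sup>2 * chi2_form m x w c c"
proof -
  define z where "z i = exp (\<tau> * b * real i)" for i
  let ?p = "lagrange_basis z m (Suc j)"
  let ?a = "gaussian_dual \<tau> m ?p"
  let ?C = "8 ^ m / ((\<tau> * b) ^ m * fact m)"
  have Cpos: "0 < ?C" using \<tau> b by simp
  have coeff: "\<bar>coeff ?p k\<bar> \<le> ?C" for k
    unfolding z_def[abs_def] using b \<tau> range j by (intro coeff_lagrange_basis_exp_le) auto
  have inj: "inj_on z {..m}" unfolding z_def using b \<tau> by (auto simp: inj_on_def)
  have dual: "has_bochner_integral lborel (\<lambda>y. ?a y * normal_density (x i) 1 y) (of_bool (i = Suc j))"
    if i: "i \<le> m" for i
  proof -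
    have "poly ?p (exp (\<tau> * x i)) = of_bool (i = Suc j)"
      using poly_lagrange_basis[OF inj i, of "Suc j"] j by (simp add: z_def x_def mult.assoc)
    then show ?thesis
      using gaussian_dual_integral[OF degree_lagrange_basis[of "Suc j" m z], of \<tau> "x i"] j by simp
  qed
  have "has_bochner_integral lborel
      (\<lambda>y. \<Sum>i<m. c i * (?a y * normal_density (x (Suc i)) 1 y - ?a y * normal_density (x 0) 1 y))
      (\<Sum>i<m. c i * (of_bool (Suc i = Suc j) - of_bool (0 = Suc j)))"
    by (intro has_bochner_integral_sum has_bochner_integral_mult_right has_bochner_integral_diff dual) auto
  also have "(\<Sum>i<m. c i * (of_bool (Suc i = Suc j) - of_bool (0 = Suc j))) = (\<Sum>i<m. if i = j then c j else 0)"
    by (intro sum.cong) auto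
  also have "\<dots> = c j" using j by simp
  also have "(\<lambda>y. \<Sum>i<m. c i * (?a y * normal_density (x (Suc i)) 1 y - ?a y * normal_density (x 0) 1 y))
      = (\<lambda>y. ?a y * perturbation m x c y)"
    by (simp add: perturbation_def node_contrast_def sum_distrib_left algebra_simps)
  finally have cj: "(\<integral>y. ?a y * perturbation m x c y \<partial>lborel) = c j"
    by (simp add: has_bochner_integral_iff)
  have gb: "(grid_bound m b \<tau>)\<^sup>2 = ((real m + 1) * ?C)\<^sup>2 * exp ((real m * \<tau>)\<^sup>2 + 2 * real m)"
    unfolding grid_bound_def power_mult_distrib by (simp flip: exp_of_nat_mult)
  have xi: "0 \<le> x i" "\<tau> * x i \<le> 1" if "i \<le> m" for i
  proof -
    have "\<tau> * b * real i \<le> \<tau> * b * real m" using that b \<tau> by (intro mult_left_mono) auto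
    then show "0 \<le> x i" "\<tau> * x i \<le> 1" using range b by (auto simp: x_def mult.assoc)
  qed
  note L2 = gaussian_dual_L2[where p="?p" and m=m, OF coeff less_imp_le[OF \<tau>] xi]
  have ia: "integrable lborel (\<lambda>y. \<Sum>i\<le>m. w i * ((?a y)\<^sup>2 * normal_density (x i) 1 y))"
    using L2(1) by (intro Bochner_Integration.integrable_sum integrable_mult_right) auto
  have eq: "(\<lambda>y. \<Sum>i\<le>m. w i * ((?a y)\<^sup>2 * normal_density (x i) 1 y)) = (\<lambda>y. (?a y)\<^sup>2 * mixture m x w y)"
    by (simp add: mixture_def sum_distrib_left mult.left_commute)
  have "(\<integral>y. (?a y)\<^sup>2 * mixture m x w y \<partial>lborel)
      = (\<Sum>i\<le>m. w i * (\<integral>y. (?a y)\<^sup>2 * normal_density (x i) 1 y \<partial>lborel))"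
    unfolding eq[symmetric] using L2(1) by (subst Bochner_Integration.integral_sum) auto
  also have "\<dots> \<le> (\<Sum>i\<le>m. w i * (grid_bound m b \<tau>)\<^sup>2)"
    unfolding gb using L2(2) w(1) by (intro sum_mono mult_left_mono) (auto intro: less_imp_le)
  also have "\<dots> = (grid_bound m b \<tau>)\<^sup>2" using w(2) by (simp flip: sum_distrib_right)
  finally have a2: "(\<integral>y. (?a y)\<^sup>2 * mixture m x w y \<partial>lborel) \<le> (grid_bound m b \<tau>)\<^sup>2" .
  have "(\<integral>y. ?a y * perturbation m x c y \<partial>lborel)\<^sup>2
      \<le> (grid_bound m b \<tau>)\<^sup>2 * (\<integral>y. (perturbation m x c y)\<^sup>2 / mixture m x w y \<partial>lborel)"
  proof (rule weighted_cauchy_schwarz)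
    show "0 < (grid_bound m b \<tau>)\<^sup>2"
      unfolding gb by (intro mult_pos_pos zero_less_power Cpos exp_gt_zero) simp
    show "integrable lborel (\<lambda>y. (?a y)\<^sup>2 * mixture m x w y)" using ia unfolding eq .
    show "integrable lborel (\<lambda>y. (perturbation m x c y)\<^sup>2 / mixture m x w y)"
      using integrable_chi2[OF w(1)] unfolding power2_eq_square .
    show "0 < mixture m x w y" for y by (rule mixture_pos[OF w(1)])
  qed (use a2 in simp_all)
  then show ?thesis unfolding cj chi2_form_def by (simp add: power2_eq_square)
qed

text \<open>
  From \<open>(f - g)\<^sup>2 = (sqrt f - sqrt g)\<^sup>2 (sqrt f + sqrt g)\<^sup>2\<close>, where the last factor lies between \<open>h\<close> and
  \<open>6 h\<close>. Both densities being comparable to \<open>h\<close> thus makes the Hellinger distance equivalent to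
  the Hilbert distance of \<open>L\<^sup>2(1/h)\<close>.
\<close>

lemma hellinger_sq_chi2_bounds:
  assumes f: "prob_density lborel f" and g: "prob_density lborel g"
    and h: "\<And>y. 0 < h y"
    and fh: "\<And>y. h y / 2 \<le> f y" "\<And>y. f y \<le> 3 / 2 * h y"
    and gh: "\<And>y. h y / 2 \<le> g y" "\<And>y. g y \<le> 3 / 2 * h y"
    and int: "integrable lborel (\<lambda>y. (f y - g y)\<^sup>2 / h y)"
  shows "(\<integral>y. (f y - g y)\<^sup>2 / h y \<partial>lborel) / 6 \<le> (hellinger lborel f g)\<^sup>2"
    and "(hellinger lborel f g)\<^sup>2 \<le> (\<integral>y. (f y - g y)\<^sup>2 / h y \<partial>lborel)"
proof -
  have both: "(f y - g y)\<^sup>2 / h y / 6 \<le> (sqrt (f y) - sqrt (g y))\<^sup>2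
      \<and> (sqrt (f y) - sqrt (g y))\<^sup>2 \<le> (f y - g y)\<^sup>2 / h y" for y
  proof -
    have nn: "0 \<le> f y" "0 \<le> g y" using h[of y] fh[of y] gh[of y] by linarith+
    let ?a = "sqrt (f y)" and ?b = "sqrt (g y)"
    have eq: "(f y - g y)\<^sup>2 = (?a - ?b)\<^sup>2 * (?a + ?b)\<^sup>2"
    proof -
      have "f y - g y = (?a - ?b) * (?a + ?b)" using nn by (simp add: algebra_simps)
      then show ?thesis by (simp only: power_mult_distrib)
    qed
    have "(?a + ?b)\<^sup>2 \<le> 2 * (f y + g y)"
      using zero_le_power2[of "?a - ?b"] nn by (simp add: power2_sum power2_diff)
    also have "\<dots> \<le> 6 * h y" using fh(2)[of y] gh(2)[of y] by simp
    finally have up: "(?a + ?b)\<^sup>2 \<le> 6 * h y" .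
    have "f y + g y \<le> (?a + ?b)\<^sup>2" using nn by (simp add: power2_sum)
    moreover have "h y \<le> f y + g y" using fh(1)[of y] gh(1)[of y] by simp
    ultimately have lo: "h y \<le> (?a + ?b)\<^sup>2" by simp
    have "(f y - g y)\<^sup>2 \<le> (?a - ?b)\<^sup>2 * (6 * h y)" "(?a - ?b)\<^sup>2 * h y \<le> (f y - g y)\<^sup>2"
      unfolding eq using up lo by (auto intro!: mult_left_mono)
    then show ?thesis using h[of y] by (simp add: field_simps)
  qed
  have "(\<integral>y. (f y - g y)\<^sup>2 / h y \<partial>lborel) / 6 = (\<integral>y. (f y - g y)\<^sup>2 / h y / 6 \<partial>lborel)"
    by (rule integral_divide_zero[symmetric])
  also have "\<dots> \<le> (hellinger lborel f g)\<^sup>2"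
    unfolding hellinger_sq
    by (intro integral_mono integrable_sqrt_diff_sq f g integrable_divide int conjunct1[OF both])
  finally show "(\<integral>y. (f y - g y)\<^sup>2 / h y \<partial>lborel) / 6 \<le> (hellinger lborel f g)\<^sup>2" .
  show "(hellinger lborel f g)\<^sup>2 \<le> (\<integral>y. (f y - g y)\<^sup>2 / h y \<partial>lborel)"
    unfolding hellinger_sq
    by (intro integral_mono integrable_sqrt_diff_sq f g int conjunct2[OF both])
qed

section \<open>The hypercube of priors on a grid\<close>

text \<open>
  The base prior gives mass \<open>exp (- m)\<close> to each of the \<open>m\<close> atoms away from \<open>0\<close>. The first bound
  leaves half of the mass at \<open>0\<close>; the second says that the perturbed priors, whose weights grow by
  at most the factor \<open>3/2\<close>, still respect the subgaussian tail.
\<close>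

lemma exp_minus_mass_bounds:
  fixes m :: nat
  shows "real m * exp (- real m) \<le> 1 / 2"
    and "3 / 2 * (real m * exp (- real m)) \<le> 2 * exp (- real m / 2)"
proof -
  have "2 * real m \<le> 1 + real m + (real m)\<^sup>2 / 2"
    using zero_le_power2[of "real m - 1"] by (simp add: power2_diff)
  also have "\<dots> \<le> exp (real m)" by (rule exp_lower_Taylor_quadratic) simp
  finally show "real m * exp (- real m) \<le> 1 / 2" by (simp add: exp_minus field_simps)
  have "3 / 4 * real m \<le> 1 + real m / 2 + (real m / 2)\<^sup>2 / 2"
    using zero_le_power2[of "real m - 1"] by (simp add: power2_diff power_divide)
  also have "\<dots> \<le> exp (real m / 2)" by (rule exp_lower_Taylor_quadratic) simp
  finally have "3 / 4 * real m * exp (- real m) \<le> exp (real m / 2) * exp (- real m)"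
    by (intro mult_right_mono) auto
  also have "\<dots> = exp (- real m / 2)" by (simp flip: exp_add)
  finally show "3 / 2 * (real m * exp (- real m)) \<le> 2 * exp (- real m / 2)" by simp
qed

text \<open>
  Orthonormalise the perturbations in \<open>L\<^sup>2(1/f)\<close> and scale them by \<open>t = 1/sqrt (2n)\<close>. Then the squared
  \<open>L\<^sup>2(1/f)\<close> distance between two vertices is exactly their Hamming distance divided by \<open>2n\<close>, as
  Assouad's lemma wants. The orthonormal directions are not explicit, but their coefficients are at
  most \<open>grid_bound\<close>, so that the hypothesis on \<open>n\<close> keeps all \<open>2^m\<close> sums within half of the base weights.
\<close>

lemma minimax_risk_grid:
  fixes b \<tau> :: real
  assumes b: "0 < b" and \<tau>: "0 < \<tau>" and range: "\<tau> * b * real m \<le> 1" and n: "0 < n"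
    and bound: "2 * real m * exp (real m) * grid_bound m b \<tau> \<le> sqrt (real n)"
    and cls: "\<And>p. (\<And>j. j \<le> m \<Longrightarrow> 0 \<le> p j) \<Longrightarrow> (\<Sum>j\<le>m. p j) = 1 \<Longrightarrow>
        (\<Sum>j=1..m. p j) \<le> 2 * exp (- real m / 2) \<Longrightarrow> atomic_prior m (\<lambda>j. b * real j) p \<in> \<G>"
  shows "ennreal (real m / (384 * real n)) \<le> minimax_risk n \<G>"
proof -
  define x where "x j = b * real j" for j
  define w where "w j = (if j = 0 then 1 - real m * exp (- real m) else exp (- real m))" for j :: nat
  define t where "t = 1 / sqrt (2 * real n)"
  let ?A = "grid_bound m b \<tau>" and ?f = "mixture m x w"
  let ?B = "chi2_form m x w"
  have w0: "1 / 2 \<le> w 0" using exp_minus_mass_bounds(1)[of m] by (simp add: w_def)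
  have wpos: "0 < w j" for j using w0 by (cases "j = 0") (auto simp: w_def)
  have wsum: "(\<Sum>j\<le>m. w j) = 1"
    by (simp add: sum.atMost_shift) (simp add: w_def)
  have A0: "0 \<le> ?A" using b \<tau> by (simp add: grid_bound_def)
  have t0: "0 < t" using n by (simp add: t_def)
  have tA: "t * (real m * ?A) \<le> exp (- real m) / 2"
  proof -
    have "2 * real m * exp (real m) * ?A \<le> sqrt (2 * real n)"
      using bound by (rule order.trans) simp
    then have "2 * real m * exp (real m) * ?A * (exp (- real m) * t) \<le> sqrt (2 * real n) * (exp (- real m) * t)"
      using t0 by (intro mult_right_mono) auto
    moreover have "2 * real m * exp (real m) * ?A * (exp (- real m) * t) = 2 * (t * (real m * ?A))"
      by (simp add: exp_minus)
    moreover have "sqrt (2 * real n) * (exp (- real m) * t) = exp (- real m)"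
      using n by (simp add: t_def)
    ultimately show ?thesis by linarith
  qed
  have pos: "0 < ?B c c" if "j < m" "c j \<noteq> 0" for c j
  proof -
    have "(c j)\<^sup>2 \<le> ?A\<^sup>2 * ?B c c"
      unfolding x_def[abs_def] by (rule grid_coefficient_bound[OF b \<tau> range wpos wsum that(1)])
    moreover have "0 < (c j)\<^sup>2" using that by simp
    ultimately have "0 < ?A\<^sup>2 * ?B c c" by linarith
    then show ?thesis by (simp add: zero_less_mult_iff)
  qed
  have "\<exists>Q. \<forall>k<m. \<forall>l<m. ?B (Q k) (Q l) = of_bool (k = l)"
  proof (rule gram_schmidt_coefficients[of ?B m])
    show "?B (\<lambda>j. u j + r * v j) d = ?B u d + r * ?B v d" for u v d r
      by (rule chi2_form_linear[OF wpos])
    show "?B u v = ?B v u" for u v by (rule chi2_form_sym)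
    show "0 < ?B c c" if "j < m" "c j \<noteq> 0" for c j using that by (rule pos)
  qed blast
  then obtain Q where Q: "\<And>k l. k < m \<Longrightarrow> l < m \<Longrightarrow> ?B (Q k) (Q l) = of_bool (k = l)"
    by blast
  have Q_le: "\<bar>Q k j\<bar> \<le> ?A" if "k < m" "j < m" for k j
  proof -
    have "(Q k j)\<^sup>2 \<le> ?A\<^sup>2 * ?B (Q k) (Q k)"
      unfolding x_def[abs_def] by (rule grid_coefficient_bound[OF b \<tau> range wpos wsum that(2)])
    then show ?thesis using Q[OF that(1) that(1)] A0 by (simp add: abs_le_square_iff[symmetric])
  qed
  define c where "c S j = (\<Sum>k\<in>S. t * Q k j)" for S j
  define p where "p S = move_mass m w (c S)" for S
  have c_le: "\<bar>c S j\<bar> \<le> exp (- real m) / 2" if S: "S \<subseteq> {..<m}" and j: "j < m" for S j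
  proof -
    have "\<bar>c S j\<bar> \<le> (\<Sum>k\<in>S. t * ?A)"
      unfolding c_def using S j t0
      by (intro order.trans[OF sum_abs] sum_mono) (auto simp: abs_mult intro!: mult_left_mono Q_le)
    also have "\<dots> = real (card S) * (t * ?A)" by simp
    also have "\<dots> \<le> real m * (t * ?A)"
      using S t0 A0 card_mono[OF _ S] by (intro mult_right_mono) auto
    also have "\<dots> \<le> exp (- real m) / 2" using tA by (simp add: mult_ac)
    finally show ?thesis .
  qed
  have p_bounds: "w j / 2 \<le> p S j \<and> p S j \<le> 3 / 2 * w j" if S: "S \<subseteq> {..<m}" and j: "j \<le> m" for S j
  proof (cases j)
    case 0
    have "\<bar>\<Sum>j<m. c S j\<bar> \<le> (\<Sum>j<m. exp (- real m) / 2)"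
      using c_le[OF S] by (intro order.trans[OF sum_abs] sum_mono) auto
    also have "\<dots> \<le> 1 / 4" using exp_minus_mass_bounds(1)[of m] by simp
    also have "\<dots> \<le> w 0 / 2" using w0 by simp
    finally have "\<bar>\<Sum>j<m. c S j\<bar> \<le> w 0 / 2" .
    then show ?thesis unfolding 0 p_def move_mass_def nat.case by linarith
  next
    case (Suc i)
    then have "\<bar>c S i\<bar> \<le> w j / 2" using c_le[OF S, of i] j by (simp add: w_def)
    then show ?thesis unfolding Suc p_def move_mass_def nat.case by linarith
  qed
  have p_nn: "0 \<le> p S j" if "S \<subseteq> {..<m}" "j \<le> m" for S j
    using p_bounds[OF that] wpos[of j] by linarith
  have p_sum: "(\<Sum>j\<le>m. p S j) = 1" for S by (simp add: p_def sum_move_mass wsum)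
  let ?G = "\<lambda>S. atomic_prior m x (p S)"
  have mix: "gaussian_mixture (?G S) = mixture m x (p S)" if "S \<subseteq> {..<m}" for S
    using p_nn[OF that] by (rule gaussian_mixture_atomic_prior)
  have dens: "prob_density lborel (mixture m x (p S))" if "S \<subseteq> {..<m}" for S
    using p_nn[OF that] p_sum by (rule prob_density_mixture)
  have f_lo: "?f y / 2 \<le> mixture m x (p S) y" and f_hi: "mixture m x (p S) y \<le> 3 / 2 * ?f y"
    if S: "S \<subseteq> {..<m}" for S y
    using mixture_mono[of m "\<lambda>j. 1 / 2 * w j" "p S" x y] mixture_mono[of m "p S" "\<lambda>j. 3 / 2 * w j" x y]
      p_bounds[OF S] unfolding mixture_scale by simp_all
  have diff: "(\<integral>y. (mixture m x (p S) y - mixture m x (p T) y)\<^sup>2 / ?f y \<partial>lborel)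
      = real (card (sym_diff S T)) / (2 * real n)"
    and int: "integrable lborel (\<lambda>y. (mixture m x (p S) y - mixture m x (p T) y)\<^sup>2 / ?f y)"
    if S: "S \<subseteq> {..<m}" and T: "T \<subseteq> {..<m}" for S T
  proof -
    let ?e = "\<lambda>k. t * (of_bool (k \<in> S) - of_bool (k \<in> T)) :: real"
    define d where "d j = c S j - c T j" for j
    have d_sum: "d = (\<lambda>j. 0 + (\<Sum>k<m. ?e k * Q k j))"
    proof
      fix j
      have "c U j = (\<Sum>k<m. t * of_bool (k \<in> U) * Q k j)" if "U \<subseteq> {..<m}" for U
        unfolding c_def using that by (intro sum.mono_neutral_cong_left) auto
      then show "d j = 0 + (\<Sum>k<m. ?e k * Q k j)"
        using S T by (simp add: d_def algebra_simps sum_subtractf)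
    qed
    have "mixture m x (p S) y - mixture m x (p T) y = perturbation m x d y" for y
      using perturbation_linear[of m x "c S" "-1" "c T" y]
      by (simp add: p_def mixture_move_mass d_def[abs_def])
    then have sq: "(mixture m x (p S) y - mixture m x (p T) y)\<^sup>2 / ?f y
        = perturbation m x d y * perturbation m x d y / ?f y" for y
      by (simp add: power2_eq_square)
    show "integrable lborel (\<lambda>y. (mixture m x (p S) y - mixture m x (p T) y)\<^sup>2 / ?f y)"
      unfolding sq by (rule integrable_chi2[OF wpos])
    have zero: "?B (\<lambda>j. 0) g = 0" for g by (simp add: chi2_form_def perturbation_def)
    have lin: "?B d g = (\<Sum>k<m. ?e k * ?B (Q k) g)" for g
      unfolding d_sum by (subst linear_form_sum[OF chi2_form_linear[OF wpos]]) (simp_all add: zero)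
    have Qd: "?B (Q k) d = ?e k" if k: "k < m" for k
    proof -
      have "?B (Q k) d = (\<Sum>l<m. ?e l * ?B (Q l) (Q k))" by (subst chi2_form_sym) (rule lin)
      also have "\<dots> = (\<Sum>l<m. if l = k then ?e k else 0)" using Q k by (intro sum.cong) auto
      finally show ?thesis using k by simp
    qed
    have "?B d d = (\<Sum>k<m. ?e k * ?e k)" unfolding lin[of d] by (intro sum.cong) (auto simp: Qd)
    also have "\<dots> = (\<Sum>k<m. if k \<in> sym_diff S T then t * t else 0)" by (intro sum.cong) auto
    also have "\<dots> = (\<Sum>k\<in>sym_diff S T. t * t)"
    proof -
      have "{..<m} \<inter> sym_diff S T = sym_diff S T" using S T by blast
      then show ?thesis using sum.inter_restrict[of "{..<m}" "\<lambda>_. t * t" "sym_diff S T"] by simp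
    qed
    also have "\<dots> = real (card (sym_diff S T)) / (2 * real n)"
      using n by (simp add: t_def)
    finally show "(\<integral>y. (mixture m x (p S) y - mixture m x (p T) y)\<^sup>2 / ?f y \<partial>lborel)
        = real (card (sym_diff S T)) / (2 * real n)"
      unfolding sq chi2_form_def .
  qed
  have hell: "real (card (sym_diff S T)) / (2 * real n) / 6
        \<le> (hellinger lborel (gaussian_mixture (?G S)) (gaussian_mixture (?G T)))\<^sup>2"
      "(hellinger lborel (gaussian_mixture (?G S)) (gaussian_mixture (?G T)))\<^sup>2
        \<le> real (card (sym_diff S T)) / (2 * real n)"
    if S: "S \<subseteq> {..<m}" and T: "T \<subseteq> {..<m}" for S T
    unfolding mix[OF S] mix[OF T] diff[OF S T, symmetric]
    by (intro hellinger_sq_chi2_bounds dens S T mixture_pos wpos f_lo f_hi int)+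
  have "ennreal (real m * (1 / (12 * real n)) / 32) \<le> minimax_risk n \<G>"
  proof (rule assouad_minimax_risk[where G="?G", OF n])
    fix S assume S: "S \<subseteq> {..<m}"
    have "(\<Sum>j=1..m. p S j) \<le> (\<Sum>j=1..m. 3 / 2 * exp (- real m))"
      using p_bounds[OF S] by (intro sum_mono) (fastforce simp: w_def)
    also have "\<dots> \<le> 2 * exp (- real m / 2)" using exp_minus_mass_bounds(2)[of m] by simp
    finally show "?G S \<in> \<G>"
      unfolding x_def[abs_def] using p_nn[OF S] p_sum by (intro cls)
    show "prob_density lborel (gaussian_mixture (?G S))" unfolding mix[OF S] by (rule dens[OF S])
  next
    fix S T assume S: "S \<subseteq> {..<m}" and T: "T \<subseteq> {..<m}"
    show "1 / (12 * real n) * real (card (sym_diff S T))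
        \<le> (hellinger lborel (gaussian_mixture (?G S)) (gaussian_mixture (?G T)))\<^sup>2"
      using hell(1)[OF S T] by simp
  next
    fix S k assume S: "S \<subseteq> {..<m}" and k: "k < m" "k \<notin> S"
    then have "sym_diff S (insert k S) = {k}" by auto
    then show "(hellinger lborel (gaussian_mixture (?G S)) (gaussian_mixture (?G (insert k S))))\<^sup>2
        \<le> 1 / (2 * real n)"
      using hell(2)[of S "insert k S"] S k by simp
  qed simp
  then show ?thesis by simp
qed

text \<open>
  Stirling's lower bound \<open>m! \<ge> (m/e)\<^sup>m\<close>, read off from one term of the series of \<open>exp m\<close>.
\<close>

lemma power_self_le_exp_fact: "real m ^ m \<le> exp (real m) * fact m"
proof -
  have "(\<Sum>k\<in>{m}. real m ^ k /\<^sub>R fact k) \<le> (\<Sum>k. real m ^ k /\<^sub>R fact k)"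
    by (intro sum_le_suminf summable_exp_generic) auto
  then have "real m ^ m / fact m \<le> exp (real m)" by (simp add: exp_def divide_inverse mult.commute)
  then show ?thesis by (simp add: field_simps)
qed

lemma grid_bound_le:
  assumes b: "0 < b" and \<tau>: "0 < \<tau>" and K: "(real m * \<tau>)\<^sup>2 \<le> K * real m"
  shows "2 * real m * exp (real m) * grid_bound m b \<tau>
    \<le> exp ((8 + K / 2) * real m) / (\<tau> * b * real m) ^ m"
proof (cases "m = 0")
  case False
  let ?\<eta> = "\<tau> * b * real m"
  have \<eta>: "0 < ?\<eta> ^ m" using False b \<tau> by simp
  have "2 * real m * (real m + 1) \<le> exp (2 * real m)"
  proof -
    have "2 * real m * (real m + 1) \<le> 1 + 2 * real m + (2 * real m)\<^sup>2 / 2"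
      by (simp add: power2_eq_square algebra_simps)
    also have "\<dots> \<le> exp (2 * real m)" by (rule exp_lower_Taylor_quadratic) simp
    finally show ?thesis .
  qed
  moreover have "8 ^ m \<le> exp (3 * real m)"
  proof -
    have "8 \<le> exp (3 :: real)" using exp_lower_Taylor_quadratic[of 3] by simp
    then have "8 ^ m \<le> exp (3 :: real) ^ m" by (intro power_mono) auto
    then show ?thesis by (simp add: mult.commute flip: exp_of_nat_mult)
  qed
  moreover have "?\<eta> ^ m / exp (real m) \<le> (\<tau> * b) ^ m * fact m"
    using power_self_le_exp_fact[of m] b \<tau>
    by (simp add: power_mult_distrib pos_divide_le_eq mult.assoc mult.commute[of "exp _"] mult_left_mono)
  ultimately have poly: "2 * real m * (real m + 1) * (8 ^ m / ((\<tau> * b) ^ m * fact m))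
      \<le> exp (2 * real m) * (exp (3 * real m) / (?\<eta> ^ m / exp (real m)))"
    using \<eta> b \<tau> by (intro mult_mono frac_le) auto
  have "exp (((real m * \<tau>)\<^sup>2 + 2 * real m) / 2) \<le> exp ((K * real m + 2 * real m) / 2)"
    using K by simp
  with poly have "(2 * real m * (real m + 1) * (8 ^ m / ((\<tau> * b) ^ m * fact m)))
        * exp (((real m * \<tau>)\<^sup>2 + 2 * real m) / 2) * exp (real m)
      \<le> (exp (2 * real m) * (exp (3 * real m) / (?\<eta> ^ m / exp (real m))))
        * exp ((K * real m + 2 * real m) / 2) * exp (real m)"
    using \<eta> by (intro mult_right_mono[OF mult_mono]) auto
  also have "\<dots> = exp ((8 + K / 2) * real m) / ?\<eta> ^ m"
    by (simp add: mult_exp_exp algebra_simps add_divide_distrib)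
  finally show ?thesis unfolding grid_bound_def by (simp only: mult_ac)
qed simp

section \<open>Choice of the grid\<close>

text \<open>
  The trade-off in logarithmic form. The number \<open>\<tau> b m\<close> is the exponent range of the Lagrange nodes. If it
  can be kept of order one, then \<open>m\<close> of order \<open>log n\<close> is admissible; if it must shrink like a power of
  \<open>m\<close>, then only \<open>m log m\<close> of order \<open>log n\<close> is.
\<close>

lemma minimax_risk_grid_log:
  fixes b \<tau> :: real
  assumes b: "0 < b" and \<tau>: "0 < \<tau>" and m: "0 < m" and range: "\<tau> * b * real m \<le> 1" and n: "0 < n"
    and K: "(real m * \<tau>)\<^sup>2 \<le> K * real m"
    and bound: "real m * (16 + K - 2 * ln (\<tau> * b * real m)) \<le> ln (real n)"
    and cls: "\<And>p. (\<And>j. j \<le> m \<Longrightarrow> 0 \<le> p j) \<Longrightarrow> (\<Sum>j\<le>m. p j) = 1 \<Longrightarrow>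
        (\<Sum>j=1..m. p j) \<le> 2 * exp (- real m / 2) \<Longrightarrow> atomic_prior m (\<lambda>j. b * real j) p \<in> \<G>"
  shows "ennreal (real m / (384 * real n)) \<le> minimax_risk n \<G>"
proof (rule minimax_risk_grid[OF b \<tau> range n _ cls])
  let ?\<eta> = "\<tau> * b * real m"
  have \<eta>: "0 < ?\<eta>" using b \<tau> m by simp
  have "2 * real m * exp (real m) * grid_bound m b \<tau> \<le> exp ((8 + K / 2) * real m) / ?\<eta> ^ m"
    by (rule grid_bound_le[OF b \<tau> K])
  also have "?\<eta> ^ m = exp (real m * ln ?\<eta>)"
    using \<eta> by (simp add: exp_of_nat_mult)
  also have "exp ((8 + K / 2) * real m) / exp (real m * ln ?\<eta>)
      = exp (real m * (16 + K - 2 * ln ?\<eta>) / 2)"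
    by (simp add: algebra_simps add_divide_distrib diff_divide_distrib flip: exp_diff)
  also have "\<dots> \<le> exp (ln (real n) / 2)" using bound by simp
  also have "\<dots> = sqrt (real n)"
    using n by (simp add: ln_sqrt[symmetric])
  finally show "2 * real m * exp (real m) * grid_bound m b \<tau> \<le> sqrt (real n)" .
qed

lemma half_le_nat_floor:
  fixes z :: real assumes "1 \<le> z"
  shows "z / 2 \<le> real (nat \<lfloor>z\<rfloor>)" "real (nat \<lfloor>z\<rfloor>) \<le> z" "0 < nat \<lfloor>z\<rfloor>"
proof -
  have "real (nat \<lfloor>z\<rfloor>) = of_int \<lfloor>z\<rfloor>" and one: "1 \<le> \<lfloor>z\<rfloor>" using assms by simp_all
  then show "z / 2 \<le> real (nat \<lfloor>z\<rfloor>)" "real (nat \<lfloor>z\<rfloor>) \<le> z" "0 < nat \<lfloor>z\<rfloor>"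
    using floor_correct[of z] by linarith+
qed

text \<open>
  The grid must fit into \<open>[0, h]\<close>, so its spacing is \<open>h/m\<close>, while \<open>\<tau>\<close> must be of order \<open>1/sqrt m\<close>. The exponent
  range is then of order \<open>1/sqrt m\<close>, which costs the factor \<open>log m\<close>, at most \<open>log (log n)\<close>.
\<close>

lemma minimax_risk_supported_priors:
  fixes h :: real
  assumes h: "0 < h"
  shows "\<exists>c0>0. \<exists>n0. \<forall>n\<ge>n0.
    ennreal (c0 / real n * (ln (real n) / ln (ln (real n)))) \<le> minimax_risk n (supported_priors {-h..h})"
proof -
  let ?g = "min h 1"
  have "filterlim (\<lambda>n. ln (ln (real n))) at_top sequentially"
    by (intro filterlim_compose[OF ln_at_top] filterlim_real_sequentially)
  then have "eventually (\<lambda>n. max 1 (17 - 2 * ln ?g) \<le> ln (ln (real n))) sequentially"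
    unfolding filterlim_at_top by (rule spec)
  moreover have "eventually (\<lambda>n. 3 \<le> real n) sequentially"
    using filterlim_real_sequentially by (simp add: filterlim_at_top)
  ultimately have "eventually (\<lambda>n. max 1 (17 - 2 * ln ?g) \<le> ln (ln (real n)) \<and> 3 \<le> real n) sequentially"
    by (rule eventually_conj)
  then obtain n0 where n0: "\<And>n. n0 \<le> n \<Longrightarrow> max 1 (17 - 2 * ln ?g) \<le> ln (ln (real n)) \<and> 3 \<le> real n"
    unfolding eventually_sequentially by blast
  have "ennreal (1 / 1536 / real n * (ln (real n) / ln (ln (real n)))) \<le> minimax_risk n (supported_priors {-h..h})"
    if "n0 \<le> n" for n
  proof -
    define X where "X = ln (real n)"
    define Y where "Y = ln X"
    have Y: "1 \<le> Y" "17 - 2 * ln ?g \<le> Y" and n3: "3 \<le> real n"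
      using n0[OF that] by (auto simp: X_def Y_def)
    have X: "0 < X" using n3 by (simp add: X_def)
    have XY: "2 * Y \<le> X"
    proof -
      have "Y = ln 2 + ln (X / 2)" using X by (simp add: Y_def ln_div)
      also have "\<dots> \<le> (2 - 1) + (X / 2 - 1)" using X by (intro add_mono ln_le_minus_one) auto
      finally show ?thesis by simp
    qed
    define m where "m = nat \<lfloor>X / (2 * Y)\<rfloor>"
    have "1 \<le> X / (2 * Y)" using XY Y by simp
    from half_le_nat_floor[OF this] have m: "X / (2 * Y) / 2 \<le> real m" "real m \<le> X / (2 * Y)" "0 < m"
      by (simp_all add: m_def)
    have m1: "1 \<le> real m" using m(3) by simp
    have mX: "real m \<le> X"
    proof -
      have "X / (2 * Y) \<le> X / 1" using X Y by (intro divide_left_mono) auto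
      then show ?thesis using m(2) by simp
    qed
    then have lnm: "ln (real m) \<le> Y" using m1 by (simp add: Y_def)
    \<comment> \<open>the factor \<open>min h 1 / h\<close> keeps both \<open>\<tau> sqrt m\<close> and the exponent range \<open>\<tau> h\<close> at most \<open>1\<close>\<close>
    define \<tau> where "\<tau> = ?g / h / sqrt (real m)"
    have eta: "\<tau> * (h / real m) * real m = ?g / sqrt (real m)" using h m1 by (simp add: \<tau>_def)
    have sm: "1 \<le> sqrt (real m)" using m1 by simp
    have gh: "?g / h \<le> 1" using h by simp
    have "ennreal (real m / (384 * real n)) \<le> minimax_risk n (supported_priors {-h..h})"
    proof (rule minimax_risk_grid_log[where b="h / real m" and \<tau>=\<tau> and K=1])
      show "0 < h / real m" "0 < \<tau>" "0 < m" "0 < n" using h m1 n3 by (auto simp: \<tau>_def)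
      show "\<tau> * (h / real m) * real m \<le> 1" unfolding eta using sm by (simp add: min_le_iff_disj)
      show "(real m * \<tau>)\<^sup>2 \<le> 1 * real m"
      proof -
        have "(real m * \<tau>)\<^sup>2 = real m * (?g / h)\<^sup>2"
          using m1 by (simp add: \<tau>_def power_mult_distrib power_divide) (simp add: power2_eq_square)
        also have "\<dots> \<le> real m * 1" using gh h by (intro mult_left_mono power_le_one) auto
        finally show ?thesis by simp
      qed
      have "ln (?g / sqrt (real m)) = ln ?g - ln (real m) / 2"
        using h m1 by (simp add: ln_div ln_sqrt)
      then have "real m * (16 + 1 - 2 * ln (\<tau> * (h / real m) * real m)) = real m * (17 - 2 * ln ?g + ln (real m))"
        unfolding eta by simp
      also have "\<dots> \<le> X / (2 * Y) * (2 * Y)"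
      proof (intro mult_mono)
        have "ln ?g \<le> 0" "0 \<le> ln (real m)" using h m1 by simp_all
        then show "0 \<le> 17 - 2 * ln ?g + ln (real m)" by linarith
      qed (use Y lnm m(2) X in auto)
      also have "\<dots> = X" using Y by simp
      finally show "real m * (16 + 1 - 2 * ln (\<tau> * (h / real m) * real m)) \<le> ln (real n)" by (simp add: X_def)
    next
      fix p :: "nat \<Rightarrow> real"
      assume p: "\<And>j. j \<le> m \<Longrightarrow> 0 \<le> p j" "(\<Sum>j\<le>m. p j) = 1"
      have "h / real m * real j \<in> {-h..h}" if "j \<le> m" for j
      proof -
        have "h * real j \<le> h * real m" using that h by simp
        moreover have "0 \<le> h * real j / real m" using h by simp
        ultimately have "- h \<le> h * real j / real m" "h * real j / real m \<le> h"
          using h m1 by (linarith, simp add: pos_divide_le_eq)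
        then show ?thesis by simp
      qed
      then have "{j. j \<le> m \<and> h / real m * real j \<in> {-h..h}} = {..m}" by auto
      then show "atomic_prior m (\<lambda>j. h / real m * real j) p \<in> supported_priors {-h..h}"
        using p by (simp add: supported_priors_def atomic_prior_in_priors measure_atomic_prior del: atLeastAtMost_iff)
    qed
    moreover have "1 / 1536 / real n * (X / Y) \<le> real m / (384 * real n)"
      using m(1) n3 Y by (simp add: field_simps)
    ultimately show ?thesis unfolding X_def Y_def by (meson ennreal_leI order.trans)
  qed
  then show ?thesis by (intro exI[of _ "1 / 1536"] conjI exI[of _ n0]) auto
qed

text \<open>
  Atoms of mass \<open>exp (- m)\<close> are allowed as far out as \<open>sqrt (s m)\<close>, and for a grid reaching that far,
  \<open>\<tau> = 1/sqrt (s m)\<close> makes the exponent range equal to \<open>1\<close>.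
\<close>

lemma minimax_risk_SubG:
  fixes s :: real
  assumes s: "0 < s"
  shows "\<exists>c1>0. \<exists>n0. \<forall>n\<ge>n0. ennreal (c1 / real n * ln (real n)) \<le> minimax_risk n (SubG s)"
proof -
  define D where "D = 16 + 1 / s"
  have D: "0 < D" using s by (simp add: D_def add_pos_pos)
  have "filterlim (\<lambda>n. ln (real n)) at_top sequentially"
    by (intro filterlim_compose[OF ln_at_top] filterlim_real_sequentially)
  then obtain n0 where n0: "\<And>n. n0 \<le> n \<Longrightarrow> D \<le> ln (real n)"
    by (auto simp: filterlim_at_top eventually_sequentially)
  have "ennreal (1 / (768 * D) / real n * ln (real n)) \<le> minimax_risk n (SubG s)" if "n0 \<le> n" for n
  proof -
    have L: "D \<le> ln (real n)" using n0[OF that] .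
    then have n: "0 < n" using D by (cases "n = 0") auto
    define m where "m = nat \<lfloor>ln (real n) / D\<rfloor>"
    have "1 \<le> ln (real n) / D" using L D by simp
    from half_le_nat_floor[OF this]
    have m: "ln (real n) / D / 2 \<le> real m" "real m \<le> ln (real n) / D" "0 < m"
      by (simp_all add: m_def)
    define b where "b = sqrt (s / real m)"
    define \<tau> where "\<tau> = 1 / sqrt (s * real m)"
    have eta: "\<tau> * b * real m = 1"
      using s m(3) by (simp add: \<tau>_def b_def real_sqrt_mult real_sqrt_divide field_simps)
    have b2: "(b * real m)\<^sup>2 = s * real m"
      using s m(3) by (simp add: b_def power_mult_distrib) (simp add: power2_eq_square)
    have b0: "0 < b" using s m(3) by (simp add: b_def)
    have "ennreal (real m / (384 * real n)) \<le> minimax_risk n (SubG s)"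
    proof (rule minimax_risk_grid_log[where b=b and \<tau>=\<tau> and K="1 / s"])
      show "0 < b" "0 < \<tau>" "0 < m" "0 < n" using s m(3) n b0 by (auto simp: \<tau>_def)
      show "\<tau> * b * real m \<le> 1" by (simp add: eta)
      show "(real m * \<tau>)\<^sup>2 \<le> 1 / s * real m"
        using s m(3) by (simp add: \<tau>_def power_mult_distrib power_divide) (simp add: power2_eq_square)
      show "real m * (16 + 1 / s - 2 * ln (\<tau> * b * real m)) \<le> ln (real n)"
        unfolding eta using m(2) D by (simp add: D_def[symmetric] pos_le_divide_eq)
    next
      fix p :: "nat \<Rightarrow> real"
      assume p: "\<And>j. j \<le> m \<Longrightarrow> 0 \<le> p j" "(\<Sum>j\<le>m. p j) = 1"
        and tail: "(\<Sum>j=1..m. p j) \<le> 2 * exp (- real m / 2)"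
      have "measure (atomic_prior m (\<lambda>j. b * real j) p) (- {-t..t}) \<le> 2 * exp (- t\<^sup>2 / (2 * s))"
        if t: "0 < t" for t
      proof -
        let ?J = "{j. j \<le> m \<and> b * real j \<in> - {-t..t}}"
        have meas: "measure (atomic_prior m (\<lambda>j. b * real j) p) (- {-t..t}) = (\<Sum>j\<in>?J. p j)"
          using p(1) by (intro measure_atomic_prior) auto
        have jt: "t < b * real j" if "j \<in> ?J" for j
        proof -
          have "0 \<le> b * real j" using b0 by simp
          then show ?thesis using that t by (simp add: not_le)
        qed
        show ?thesis
        proof (cases "?J = {}")
          case True
          then show ?thesis unfolding meas by (simp only: True) simp
        next
          case False
          then obtain j where j: "j \<in> ?J" by blast
          have "b * real j \<le> b * real m" using j b0 by simp
          then have "t \<le> b * real m" using jt[OF j] by simp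
          then have "t\<^sup>2 \<le> s * real m" using t unfolding b2[symmetric] by (intro power_mono) auto
          then have "- real m / 2 \<le> - t\<^sup>2 / (2 * s)" using s by (simp add: field_simps)
          moreover have "(\<Sum>j\<in>?J. p j) \<le> (\<Sum>j=1..m. p j)"
          proof (rule sum_mono2)
            show "?J \<subseteq> {1..m}" using jt t by (fastforce simp: Suc_le_eq intro: gr0I)
          qed (use p(1) in auto)
          ultimately show ?thesis unfolding meas using tail
            by (meson exp_le_cancel_iff mult_left_mono order.trans zero_le_numeral)
        qed
      qed
      then show "atomic_prior m (\<lambda>j. b * real j) p \<in> SubG s"
        using p by (simp add: SubG_def atomic_prior_in_priors)
    qed
    moreover have "1 / (768 * D) / real n * ln (real n) \<le> real m / (384 * real n)"
      using m(1) n D by (simp add: field_simps)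
    ultimately show ?thesis by (meson ennreal_leI order.trans)
  qed
  then show ?thesis using D by (intro exI[of _ "1 / (768 * D)"] conjI exI[of _ n0]) auto
qed

section \<open>The lower bounds\<close>

theorem theorem20:
  "(\<forall>h::real. h > 0 \<longrightarrow>
      (\<exists>c0::real. c0 > 0 \<and> (\<exists>n0::nat. \<forall>n\<ge>n0.
         minimax_risk n (supported_priors {-h..h})
           \<ge> ennreal (c0 / real n * (ln (real n) / ln (ln (real n))))))) \<and>
   (\<forall>s::real. s > 0 \<longrightarrow>
      (\<exists>c1::real. c1 > 0 \<and> (\<exists>n0::nat. \<forall>n\<ge>n0.
         minimax_risk n (SubG s) \<ge> ennreal (c1 / real n * ln (real n)))))"
  using minimax_risk_supported_priors minimax_risk_SubG by blast

end
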